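(* For every cheap-talk game $\Gamma(\pi^\circ,u,v)$ there exists a truthful equilibrium in which both experts obtain their commitment value, i.e. each expert's equilibrium payoff equals $\mathrm{cav}\,\overline{u}(\pi^\circ)$.
   Context: Notation. $\Omega$ (states) and $A$ (actions) are finite non-empty sets; $\pi^\circ\in\Delta(\Omega)$ is the common prior; $u,v:A\times\Omega\to\mathbb{R}$ are the payoff functions of the experts (both experts have the same payoff $u$) and of the decision-maker, respectively. $\Delta(X)$ is the set of (discrete) probability distributions on $X$. Payoffs are extended linearly: $u(\alpha,\pi)=\sum_{a,\omega}\alpha(a)\pi(\omega)u(a,\omega)$ for $\alpha\in\Delta(A)$, $\pi\in\Delta(\Omega)$, and likewise $v(\alpha,\pi)$. $BR(\pi)=\{\alpha\in\Delta(A): v(\alpha,\pi)\ge v(\alpha',\pi)\ \forall \alpha'\in\Delta(A)\}$. $\overline{u}(\pi)=\max_{\alpha\in BR(\pi)}u(\alpha,\pi)$, and $\mathrm{cav}\,\overline{u}$ is the concavification of $\overline u$, i.e. the smallest concave function on $\Delta(\Omega)$ that is pointwise $\ge\overline{u}$. The number $\mathrm{cav}\,\overline{u}(\pi^\circ)$ is called the commitment value. Experiments. A statistical experiment $\sigma$ is a partition of $\Omega\times[0,1]$ into finitely many Lebesgue measurable subsets, called signals. $\Sigma$ is the set of all experiments. The pair $(\omega,x)\in\Omega\times[0,1]$ is drawn from $\pi^\circ\times U[0,1]$, where $U[0,1]$ is uniform; the realized signal of $\sigma$ is the cell $s\in\sigma$ containing $(\omega,x)$. Hence the probability of $(s_1,s_2)\in\sigma_1\times\sigma_2$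 conditional on $\omega$ is the Lebesgue measure of $\{x:(\omega,x)\in s_1\cap s_2\}$; in particular if both experts choose the same experiment their signals coincide. Cheap-talk game $\Gamma(\pi^\circ,u,v)$. Stage 1: experts $1,2$ simultaneously choose experiments $\sigma_1,\sigma_2\in\Sigma$, which are publicly observed; then Nature draws $(\omega,x)$. Stage 2: expert $i$ privately observes his signal $s_i\in\sigma_i$ and (simultaneously with the other expert) sends a private message $m_i\in M_i$ to the decision-maker; the message set $M_i$ is rich enough to communicate any signal realization (for every experiment, its signals can be injectively encoded as messages in $M_i$). Stage 3: the decision-maker observes $(\sigma_1,\sigma_2,m_1,m_2)$, but not the signals, and chooses an action. A strategy of expert $i$ is $(\sigma_i,\tau_i)$ with $\sigma_i\in\Sigma$ and $\tau_i(\sigma_i,\sigma_j,s_i)\in\Delta(M_i)$; a strategy of the decision-maker is a map $\alpha$ giving $\alpha(\sigma_1,\sigma_2,m_1,m_2)\in\Delta(A)$. Each choice $(\sigma_1,\sigma_2)$ starts a proper sub-game. Equilibrium means weak perfect Bayesian equilibrium with beliefs consistent with the chosen experiments, also off path: for every $(\sigma_1,\sigma_2)$, (i) after each message pair the decision-maker holds a belief $\pi(m_1,m_2)\in\Delta(\Omega)$, given by Bayes' rule in the sub-game if $(m_1,m_2)$ has positive probability in that sub-game, and otherwise an arbitrary average of posteriors conditional on signal pairs $(s_1,s_2)$ of positive probability; (ii) the decision-maker plays a best-reply $\alpha(\sigma_1,\sigma_2,m_1,m_2)\in BR(\pi(m_1,m_2))$; (iii) each expert's message strategy is optimal at each signal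 of positive probability, given the other strategies; and (iv) at stage 1 no expert gains by choosing another experiment. An equilibrium is truthful if both experts choose the same experiment at stage 1 and truthfully report their common signal realization at stage 2 (following that choice). *)

theory Defs
  imports "HOL-Probability.Probability"
begin

section \<open>Beliefs, best replies and the commitment value\<close>

text \<open>
  The states form the finite type \<open>'w\<close> and the actions the finite type \<open>'a\<close>. Distributions
  on these are vectors in the probability simplex, so that \<^const>\<open>convex\<close>,
  \<^const>\<open>concave_on\<close> and \<^const>\<open>hull\<close> apply to them. Distributions on the (possibly infinite)
  message sets are values of type \<^typ>\<open>'m pmf\<close>.
\<close>

definition prob_simplex :: "(real ^ 'x::finite) set" where
  "prob_simplex = {p. (\<forall>i. 0 \<le> p $ i) \<and> (\<Sum>i\<in>UNIV. p $ i) = 1}"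

definition expected_payoff ::
  "('a::finite \<Rightarrow> 'w::finite \<Rightarrow> real) \<Rightarrow> real ^ 'a \<Rightarrow> real ^ 'w \<Rightarrow> real" where
  "expected_payoff u \<alpha> \<pi> = (\<Sum>a\<in>UNIV. \<Sum>w\<in>UNIV. \<alpha> $ a * \<pi> $ w * u a w)"

definition BR :: "('a::finite \<Rightarrow> 'w::finite \<Rightarrow> real) \<Rightarrow> real ^ 'w \<Rightarrow> (real ^ 'a) set" where
  "BR v \<pi> = {\<alpha> \<in> prob_simplex.
     \<forall>\<alpha>' \<in> prob_simplex. expected_payoff v \<alpha>' \<pi> \<le> expected_payoff v \<alpha> \<pi>}"

text \<open>
  \<^const>\<open>Max\<close> is only meaningful for finite sets, hence \<^const>\<open>Greatest\<close>; the greatest element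
  exists because \<open>BR v \<pi>\<close> is compact and non-empty.
\<close>

definition ubar ::
  "('a::finite \<Rightarrow> 'w::finite \<Rightarrow> real) \<Rightarrow> ('a \<Rightarrow> 'w \<Rightarrow> real) \<Rightarrow> real ^ 'w \<Rightarrow> real" where
  "ubar u v \<pi> = (GREATEST r. r \<in> (\<lambda>\<alpha>. expected_payoff u \<alpha> \<pi>) ` BR v \<pi>)"

definition concave_majorants :: "(real ^ 'w::finite \<Rightarrow> real) \<Rightarrow> (real ^ 'w \<Rightarrow> real) set" where
  "concave_majorants f = {g. concave_on prob_simplex g \<and> (\<forall>\<pi>\<in>prob_simplex. f \<pi> \<le> g \<pi>)}"

definition cav :: "(real ^ 'w::finite \<Rightarrow> real) \<Rightarrow> real ^ 'w \<Rightarrow> real" where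
  "cav f \<pi> = (INF g \<in> concave_majorants f. g \<pi>)"

text \<open>
  For \<open>f\<close> bounded above on the simplex, the pointwise infimum is itself the smallest concave
  function above \<open>f\<close>.
\<close>

lemma convex_prob_simplex: "convex (prob_simplex :: (real ^ 'x::finite) set)"
  by (auto simp: convex_def prob_simplex_def sum.distrib simp flip: sum_distrib_left)

lemma cav_smallest:
  fixes f :: "real ^ 'w::finite \<Rightarrow> real"
  assumes "bdd_above (f ` prob_simplex)"
  shows "cav f \<in> concave_majorants f"
    and "g \<in> concave_majorants f \<Longrightarrow> \<pi> \<in> prob_simplex \<Longrightarrow> cav f \<pi> \<le> g \<pi>"
proof -
  obtain B where B: "\<And>\<pi>. \<pi> \<in> prob_simplex \<Longrightarrow> f \<pi> \<le> B"
    using assms by (auto simp: bdd_above_def)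
  have "(\<lambda>_. B) \<in> concave_majorants f"
    using B convex_prob_simplex by (auto simp: concave_majorants_def concave_on_iff simp flip: distrib_right)
  then have ne: "concave_majorants f \<noteq> {}" by blast
  have bdd: "bdd_below ((\<lambda>g. g \<pi>) ` concave_majorants f)" if "\<pi> \<in> prob_simplex" for \<pi>
    using that by (auto simp: bdd_below_def concave_majorants_def)
  have le: "cav f \<pi> \<le> g \<pi>" if "g \<in> concave_majorants f" "\<pi> \<in> prob_simplex" for g \<pi>
    unfolding cav_def using that bdd by (intro cINF_lower) auto
  then show "g \<in> concave_majorants f \<Longrightarrow> \<pi> \<in> prob_simplex \<Longrightarrow> cav f \<pi> \<le> g \<pi>" .
  have "concave_on prob_simplex (cav f)"
    unfolding concave_on_iff
  proof (intro conjI ballI allI impI convex_prob_simplex)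
    fix x y :: "real ^ 'w" and s t :: real
    assume xy: "x \<in> prob_simplex" "y \<in> prob_simplex" and st: "0 \<le> s" "0 \<le> t" "s + t = 1"
    show "s * cav f x + t * cav f y \<le> cav f (s *\<^sub>R x + t *\<^sub>R y)"
      unfolding cav_def[of f "s *\<^sub>R x + t *\<^sub>R y"]
    proof (rule cINF_greatest[OF ne])
      fix g assume g: "g \<in> concave_majorants f"
      have "s * cav f x + t * cav f y \<le> s * g x + t * g y"
        using le[OF g] xy st by (intro add_mono mult_left_mono) auto
      also have "\<dots> \<le> g (s *\<^sub>R x + t *\<^sub>R y)"
        using g xy st by (auto simp: concave_majorants_def concave_on_iff)
      finally show "s * cav f x + t * cav f y \<le> g (s *\<^sub>R x + t *\<^sub>R y)" .
    qed
  qed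
  moreover have "f \<pi> \<le> cav f \<pi>" if "\<pi> \<in> prob_simplex" for \<pi>
    unfolding cav_def using that by (intro cINF_greatest[OF ne]) (auto simp: concave_majorants_def)
  ultimately show "cav f \<in> concave_majorants f"
    by (auto simp: concave_majorants_def)
qed


section \<open>Experiments\<close>

type_synonym 'w signal = "('w \<times> real) set"
type_synonym 'w stat_experiment = "'w signal set"

definition experiments :: "'w::finite stat_experiment set" where
  "experiments = {\<sigma>. finite \<sigma> \<and> partition_on (UNIV \<times> {0..1}) \<sigma> \<and>
     \<sigma> \<subseteq> sets (count_space UNIV \<Otimes>\<^sub>M lebesgue)}"

definition cond_prob_state :: "'w signal \<Rightarrow> 'w \<Rightarrow> real" where
  "cond_prob_state E w = measure lebesgue {x. (w, x) \<in> E}"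

definition event_prob :: "real ^ 'w::finite \<Rightarrow> 'w signal \<Rightarrow> real" where
  "event_prob \<pi>0 E = (\<Sum>w\<in>UNIV. \<pi>0 $ w * cond_prob_state E w)"

definition posterior :: "real ^ 'w::finite \<Rightarrow> 'w signal \<Rightarrow> real ^ 'w" where
  "posterior \<pi>0 E = (\<chi> w. \<pi>0 $ w * cond_prob_state E w / event_prob \<pi>0 E)"


section \<open>The cheap-talk game\<close>

text \<open>
  An assessment consists of the strategies of the two experts, the strategy of the decision-maker
  and the beliefs of the decision-maker. The message strategy of each expert takes the expert's own
  experiment first and the other expert's experiment second, whereas \<open>act\<close> and \<open>bel\<close> take the
  experiment of expert 1 first. The message sets are the types \<open>'m\<close> and \<open>'n\<close>.
\<close>

record ('w::finite, 'a::finite, 'm, 'n) assessment =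
  exp1 :: "'w stat_experiment"
  msg1 :: "'w stat_experiment \<Rightarrow> 'w stat_experiment \<Rightarrow> 'w signal \<Rightarrow> 'm pmf"
  exp2 :: "'w stat_experiment"
  msg2 :: "'w stat_experiment \<Rightarrow> 'w stat_experiment \<Rightarrow> 'w signal \<Rightarrow> 'n pmf"
  act :: "'w stat_experiment \<Rightarrow> 'w stat_experiment \<Rightarrow> 'm \<Rightarrow> 'n \<Rightarrow> real ^ 'a"
  bel :: "'w stat_experiment \<Rightarrow> 'w stat_experiment \<Rightarrow> 'm \<Rightarrow> 'n \<Rightarrow> real ^ 'w"

text \<open>
  In the following definitions for a sub-game \<open>(\<sigma>1, \<sigma>2)\<close>, the functions \<open>t1\<close> and \<open>t2\<close> are the
  message strategies in that sub-game. Given the signals, the messages are independent.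
\<close>

definition msg_prob_state ::
  "'w stat_experiment \<Rightarrow> 'w stat_experiment \<Rightarrow> ('w signal \<Rightarrow> 'm pmf) \<Rightarrow> ('w signal \<Rightarrow> 'n pmf)
     \<Rightarrow> 'm \<Rightarrow> 'n \<Rightarrow> 'w \<Rightarrow> real" where
  "msg_prob_state \<sigma>1 \<sigma>2 t1 t2 m1 m2 w =
     (\<Sum>s1\<in>\<sigma>1. \<Sum>s2\<in>\<sigma>2. cond_prob_state (s1 \<inter> s2) w * pmf (t1 s1) m1 * pmf (t2 s2) m2)"

definition msg_prob ::
  "real ^ 'w::finite \<Rightarrow> 'w stat_experiment \<Rightarrow> 'w stat_experiment \<Rightarrow> ('w signal \<Rightarrow> 'm pmf)
     \<Rightarrow> ('w signal \<Rightarrow> 'n pmf) \<Rightarrow> 'm \<Rightarrow> 'n \<Rightarrow> real" where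
  "msg_prob \<pi>0 \<sigma>1 \<sigma>2 t1 t2 m1 m2 =
     (\<Sum>w\<in>UNIV. \<pi>0 $ w * msg_prob_state \<sigma>1 \<sigma>2 t1 t2 m1 m2 w)"

definition bayes_belief ::
  "real ^ 'w::finite \<Rightarrow> 'w stat_experiment \<Rightarrow> 'w stat_experiment \<Rightarrow> ('w signal \<Rightarrow> 'm pmf)
     \<Rightarrow> ('w signal \<Rightarrow> 'n pmf) \<Rightarrow> 'm \<Rightarrow> 'n \<Rightarrow> real ^ 'w" where
  "bayes_belief \<pi>0 \<sigma>1 \<sigma>2 t1 t2 m1 m2 =
     (\<chi> w. \<pi>0 $ w * msg_prob_state \<sigma>1 \<sigma>2 t1 t2 m1 m2 w / msg_prob \<pi>0 \<sigma>1 \<sigma>2 t1 t2 m1 m2)"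

definition consistent_beliefs ::
  "real ^ 'w::finite \<Rightarrow> 'w stat_experiment \<Rightarrow> 'w stat_experiment \<Rightarrow> ('w signal \<Rightarrow> 'm pmf)
     \<Rightarrow> ('w signal \<Rightarrow> 'n pmf) \<Rightarrow> ('m \<Rightarrow> 'n \<Rightarrow> real ^ 'w) \<Rightarrow> bool" where
  "consistent_beliefs \<pi>0 \<sigma>1 \<sigma>2 t1 t2 b \<longleftrightarrow> (\<forall>m1 m2.
     if msg_prob \<pi>0 \<sigma>1 \<sigma>2 t1 t2 m1 m2 > 0
     then b m1 m2 = bayes_belief \<pi>0 \<sigma>1 \<sigma>2 t1 t2 m1 m2
     else b m1 m2 \<in> convex hull
       {posterior \<pi>0 (s1 \<inter> s2) | s1 s2. s1 \<in> \<sigma>1 \<and> s2 \<in> \<sigma>2 \<and> event_prob \<pi>0 (s1 \<inter> s2) > 0})"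

text \<open>
  The payoff of an expert with signal \<open>s\<close> who draws the message from \<open>\<mu>\<close> while the other expert uses
  \<open>t'\<close> in experiment \<open>\<sigma>'\<close>. In \<open>c\<close> the own message comes first; \<open>axis w 1\<close> is the belief
  concentrated on \<open>w\<close>.
\<close>

definition interim_payoff ::
  "('a::finite \<Rightarrow> 'w::finite \<Rightarrow> real) \<Rightarrow> real ^ 'w \<Rightarrow> 'w stat_experiment \<Rightarrow> ('w signal \<Rightarrow> 'n pmf)
     \<Rightarrow> ('m \<Rightarrow> 'n \<Rightarrow> real ^ 'a) \<Rightarrow> 'w signal \<Rightarrow> 'm pmf \<Rightarrow> real" where
  "interim_payoff u \<pi>0 \<sigma>' t' c s \<mu> =
     (\<Sum>w\<in>UNIV. \<Sum>s'\<in>\<sigma>'. \<pi>0 $ w * cond_prob_state (s \<inter> s') w / event_prob \<pi>0 s *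
        measure_pmf.expectation \<mu> (\<lambda>m. measure_pmf.expectation (t' s')
          (\<lambda>m'. expected_payoff u (c m m') (axis w 1))))"

definition optimal_messages ::
  "('a::finite \<Rightarrow> 'w::finite \<Rightarrow> real) \<Rightarrow> real ^ 'w \<Rightarrow> 'w stat_experiment \<Rightarrow> 'w stat_experiment
     \<Rightarrow> ('w signal \<Rightarrow> 'm pmf) \<Rightarrow> ('w signal \<Rightarrow> 'n pmf) \<Rightarrow> ('m \<Rightarrow> 'n \<Rightarrow> real ^ 'a) \<Rightarrow> bool" where
  "optimal_messages u \<pi>0 \<sigma> \<sigma>' t t' c \<longleftrightarrow> (\<forall>s\<in>\<sigma>. event_prob \<pi>0 s > 0 \<longrightarrow>
     (\<forall>\<mu>. interim_payoff u \<pi>0 \<sigma>' t' c s \<mu> \<le> interim_payoff u \<pi>0 \<sigma>' t' c s (t s)))"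

definition subgame_payoff ::
  "('a::finite \<Rightarrow> 'w::finite \<Rightarrow> real) \<Rightarrow> real ^ 'w \<Rightarrow> ('w, 'a, 'm, 'n) assessment
     \<Rightarrow> 'w stat_experiment \<Rightarrow> 'w stat_experiment \<Rightarrow> real" where
  "subgame_payoff u \<pi>0 E \<sigma>1 \<sigma>2 =
     (\<Sum>w\<in>UNIV. \<Sum>s1\<in>\<sigma>1. \<Sum>s2\<in>\<sigma>2. \<pi>0 $ w * cond_prob_state (s1 \<inter> s2) w *
        measure_pmf.expectation (msg1 E \<sigma>1 \<sigma>2 s1) (\<lambda>m1. measure_pmf.expectation (msg2 E \<sigma>2 \<sigma>1 s2)
          (\<lambda>m2. expected_payoff u (act E \<sigma>1 \<sigma>2 m1 m2) (axis w 1))))"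

definition equilibrium ::
  "real ^ 'w::finite \<Rightarrow> ('a::finite \<Rightarrow> 'w \<Rightarrow> real) \<Rightarrow> ('a \<Rightarrow> 'w \<Rightarrow> real)
     \<Rightarrow> ('w, 'a, 'm, 'n) assessment \<Rightarrow> bool" where
  "equilibrium \<pi>0 u v E \<longleftrightarrow>
     exp1 E \<in> experiments \<and> exp2 E \<in> experiments \<and>
     (\<forall>\<sigma>1\<in>experiments. \<forall>\<sigma>2\<in>experiments.
        consistent_beliefs \<pi>0 \<sigma>1 \<sigma>2 (msg1 E \<sigma>1 \<sigma>2) (msg2 E \<sigma>2 \<sigma>1) (bel E \<sigma>1 \<sigma>2) \<and>
        (\<forall>m1 m2. act E \<sigma>1 \<sigma>2 m1 m2 \<in> BR v (bel E \<sigma>1 \<sigma>2 m1 m2)) \<and>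
        optimal_messages u \<pi>0 \<sigma>1 \<sigma>2 (msg1 E \<sigma>1 \<sigma>2) (msg2 E \<sigma>2 \<sigma>1) (act E \<sigma>1 \<sigma>2) \<and>
        optimal_messages u \<pi>0 \<sigma>2 \<sigma>1 (msg2 E \<sigma>2 \<sigma>1) (msg1 E \<sigma>1 \<sigma>2)
          (\<lambda>m2 m1. act E \<sigma>1 \<sigma>2 m1 m2)) \<and>
     (\<forall>\<sigma>\<in>experiments. subgame_payoff u \<pi>0 E \<sigma> (exp2 E) \<le> subgame_payoff u \<pi>0 E (exp1 E) (exp2 E)) \<and>
     (\<forall>\<sigma>\<in>experiments. subgame_payoff u \<pi>0 E (exp1 E) \<sigma> \<le> subgame_payoff u \<pi>0 E (exp1 E) (exp2 E))"

text \<open>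
  An encoding witnesses that a message set is rich enough to communicate any signal realization:
  \<open>e \<sigma> s\<close> is the message reporting the signal \<open>s\<close> of \<open>\<sigma>\<close>.
\<close>

definition encoding :: "('w::finite stat_experiment \<Rightarrow> 'w signal \<Rightarrow> 'm) \<Rightarrow> bool" where
  "encoding e \<longleftrightarrow> (\<forall>\<sigma>\<in>experiments. inj_on (e \<sigma>) \<sigma>)"

definition truthful ::
  "('w::finite stat_experiment \<Rightarrow> 'w signal \<Rightarrow> 'm) \<Rightarrow> ('w stat_experiment \<Rightarrow> 'w signal \<Rightarrow> 'n)
     \<Rightarrow> ('w, 'a::finite, 'm, 'n) assessment \<Rightarrow> bool" where
  "truthful e1 e2 E \<longleftrightarrow> exp1 E = exp2 E \<and>
     (\<forall>s\<in>exp1 E. msg1 E (exp1 E) (exp2 E) s = return_pmf (e1 (exp1 E) s) \<and>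
                 msg2 E (exp2 E) (exp1 E) s = return_pmf (e2 (exp2 E) s))"

text \<open>Both experts have the payoff function \<open>u\<close>, so this is the payoff of either of them.\<close>

definition equilibrium_payoff ::
  "('a::finite \<Rightarrow> 'w::finite \<Rightarrow> real) \<Rightarrow> real ^ 'w \<Rightarrow> ('w, 'a, 'm, 'n) assessment \<Rightarrow> real" where
  "equilibrium_payoff u \<pi>0 E = subgame_payoff u \<pi>0 E (exp1 E) (exp2 E)"

end

theory Submission
  imports Defs
begin

text \<open>
  On the path both experts run an experiment inducing an optimal splitting
  \<open>\<pi>0 = \<Sum>s. l s * \<pi> s\<close> of the prior with \<open>cav (ubar u v) \<pi>0 = \<Sum>s. l s * r s\<close>; it exists because
  the graph \<open>{(\<pi>, u(\<alpha>, \<pi>)) | \<alpha> \<in> BR v \<pi>}\<close> has a compact convex hull. If the experts choose any other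
  pair of experiments, they babble, which yields at most \<open>ubar u v \<pi>0\<close>. If on the path the reports
  \<open>s\<close> and \<open>t\<close> disagree, the decision-maker does not know who lied, so his reply has to deter an
  expert with signal \<open>s\<close> and one with signal \<open>t\<close> at once. By optimality of the splitting, no best reply
  to a belief \<open>(1 - p) \<pi> s + p \<pi> t\<close> pays more than \<open>(1 - p) r s + p r t\<close>, so each such reply deters at
  least one of them, and a connectedness argument produces one that deters both.
\<close>

section \<open>Payoffs and best replies\<close>

lemma expected_payoff_add_left:
  "expected_payoff u (\<alpha> + \<beta>) \<pi> = expected_payoff u \<alpha> \<pi> + expected_payoff u \<beta> \<pi>"
  by (simp add: expected_payoff_def algebra_simps sum.distrib)

lemma expected_payoff_add_right:
  "expected_payoff u \<alpha> (\<pi> + \<pi>') = expected_payoff u \<alpha> \<pi> + expected_payoff u \<alpha> \<pi>'"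
  by (simp add: expected_payoff_def algebra_simps sum.distrib)

lemma expected_payoff_scale_left: "expected_payoff u (c *\<^sub>R \<alpha>) \<pi> = c * expected_payoff u \<alpha> \<pi>"
  by (simp add: expected_payoff_def algebra_simps sum_distrib_left)

lemma expected_payoff_scale_right: "expected_payoff u \<alpha> (c *\<^sub>R \<pi>) = c * expected_payoff u \<alpha> \<pi>"
  by (simp add: expected_payoff_def algebra_simps sum_distrib_left)

lemmas expected_payoff_linear =
  expected_payoff_add_left expected_payoff_add_right
  expected_payoff_scale_left expected_payoff_scale_right

lemma expected_payoff_axis: "expected_payoff u \<alpha> (axis w 1) = (\<Sum>a\<in>UNIV. \<alpha> $ a * u a w)"
  unfolding expected_payoff_def
  by (rule sum.cong) (auto simp: axis_def if_distrib[of "\<lambda>x. _ * x * _"] cong: if_cong)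

text \<open>Interim and sub-game payoffs are defined state by state, with point beliefs
  \<open>axis w 1\<close>. By linearity in the belief, averaging them gives back the payoff at
  \<pi>.\<close>

lemma sum_expected_payoff_axis:
  "(\<Sum>w\<in>UNIV. \<pi> $ w * expected_payoff u \<alpha> (axis w 1)) = expected_payoff u \<alpha> \<pi>"
  unfolding expected_payoff_axis unfolding expected_payoff_def sum_distrib_left
  by (subst sum.swap) (simp add: ac_simps)

lemma continuous_on_expected_payoff [continuous_intros]:
  fixes f :: "_ \<Rightarrow> real ^ 'a::finite" and g :: "_ \<Rightarrow> real ^ 'w::finite"
  assumes "continuous_on X f" "continuous_on X g"
  shows "continuous_on X (\<lambda>x. expected_payoff u (f x) (g x))"
  unfolding expected_payoff_def by (intro continuous_intros assms)

lemma prob_simplexD: "p \<in> prob_simplex \<Longrightarrow> 0 \<le> p $ i" "p \<in> prob_simplex \<Longrightarrow> sum (($) p) UNIV = 1"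
  by (auto simp: prob_simplex_def)

lemma prob_simplex_le_1: "p \<in> prob_simplex \<Longrightarrow> p $ i \<le> 1"
  using member_le_sum[of i UNIV "($) p"] by (auto simp: prob_simplex_def)

lemma compact_prob_simplex: "compact (prob_simplex :: (real ^ 'x::finite) set)"
proof -
  have "prob_simplex = {p :: real ^ 'x. \<forall>i. 0 \<le> p $ i} \<inter> {p. (\<Sum>i\<in>UNIV. p $ i) = 1}"
    by (auto simp: prob_simplex_def)
  also have "closed \<dots>"
    by (intro closed_Int closed_Collect_all closed_Collect_le closed_Collect_eq continuous_intros)
  finally have "closed (prob_simplex :: (real ^ 'x) set)" .
  moreover have "norm p \<le> 1" if "p \<in> prob_simplex" for p :: "real ^ 'x"
    using norm_le_l1_cart[of p] prob_simplexD[OF that] by simp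
  then have "bounded (prob_simplex :: (real ^ 'x) set)"
    by (auto simp: bounded_iff)
  ultimately show ?thesis
    by (simp add: compact_eq_bounded_closed)
qed

lemma axis_in_prob_simplex: "axis i 1 \<in> (prob_simplex :: (real ^ 'x::finite) set)"
  by (auto simp: prob_simplex_def axis_def)

lemma BR_nonempty: "BR v \<pi> \<noteq> {}"
proof -
  have "\<exists>\<alpha>\<in>prob_simplex. \<forall>\<alpha>'\<in>prob_simplex. expected_payoff v \<alpha>' \<pi> \<le> expected_payoff v \<alpha> \<pi>"
    using axis_in_prob_simplex
    by (intro continuous_attains_sup compact_prob_simplex continuous_intros) auto
  then show ?thesis
    by (auto simp: BR_def)
qed

lemma BR_subset: "\<alpha> \<in> BR v \<pi> \<Longrightarrow> \<alpha> \<in> prob_simplex"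
  by (simp add: BR_def)

lemma convex_BR: "convex (BR (v :: 'a::finite \<Rightarrow> 'w::finite \<Rightarrow> real) \<pi>)"
proof (rule convexI)
  fix x y :: "real ^ 'a" and s t :: real
  assume xy: "x \<in> BR v \<pi>" "y \<in> BR v \<pi>" and st: "0 \<le> s" "0 \<le> t" "s + t = 1"
  have "expected_payoff v z \<pi> \<le> expected_payoff v (s *\<^sub>R x + t *\<^sub>R y) \<pi>" if "z \<in> prob_simplex" for z
  proof -
    have "expected_payoff v z \<pi> = s * expected_payoff v z \<pi> + t * expected_payoff v z \<pi>"
      using st by (simp flip: distrib_right)
    also have "\<dots> \<le> s * expected_payoff v x \<pi> + t * expected_payoff v y \<pi>"
      using xy that st by (intro add_mono mult_left_mono) (auto simp: BR_def)
    finally show ?thesis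
      by (simp add: expected_payoff_linear)
  qed
  then show "s *\<^sub>R x + t *\<^sub>R y \<in> BR v \<pi>"
    using xy st convexD[OF convex_prob_simplex] by (auto simp: BR_def)
qed

text \<open>Each deviation \<open>\<alpha>'\<close> cuts a closed set out of the compact product of
  \<open>X\<close> and the simplex, and the graph is the intersection of these sets. The map
  \<open>P\<close> is the identity when the graph is taken over beliefs, and a parametrised segment
  of beliefs in the connectedness argument.\<close>

lemma compact_BR_graph:
  fixes P :: "'b::t2_space \<Rightarrow> real ^ 'w::finite" and v :: "'a::finite \<Rightarrow> 'w \<Rightarrow> real"
  assumes "compact X" "continuous_on UNIV P"
  shows "compact {(x, \<alpha>). x \<in> X \<and> \<alpha> \<in> BR v (P x)}"
proof -
  have "closed {z. expected_payoff v \<alpha>' (P (fst z)) \<le> expected_payoff v (snd z) (P (fst z))}" for \<alpha>'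
    by (intro closed_Collect_le continuous_intros continuous_on_compose2[OF assms(2)]) auto
  then have "compact (X \<times> prob_simplex \<inter> (\<Inter>\<alpha>'\<in>prob_simplex.
      {z. expected_payoff v \<alpha>' (P (fst z)) \<le> expected_payoff v (snd z) (P (fst z))}))"
    by (intro compact_Int_closed compact_Times compact_prob_simplex assms closed_INT) auto
  also have "X \<times> prob_simplex \<inter> (\<Inter>\<alpha>'\<in>prob_simplex.
      {z. expected_payoff v \<alpha>' (P (fst z)) \<le> expected_payoff v (snd z) (P (fst z))}) =
      {(x, \<alpha>). x \<in> X \<and> \<alpha> \<in> BR v (P x)}"
    by (auto simp: BR_def)
  finally show ?thesis .
qed

text \<open>The best replies to one belief are a slice of the compact graph, so the payoff has a
  maximum on them and \<open>Greatest\<close> in \<open>ubar\<close> denotes it.\<close>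

lemma ubar_attained:
  "\<exists>\<alpha>\<in>BR v \<pi>. ubar u v \<pi> = expected_payoff u \<alpha> \<pi> \<and>
     (\<forall>\<beta>\<in>BR v \<pi>. expected_payoff u \<beta> \<pi> \<le> expected_payoff u \<alpha> \<pi>)"
proof -
  have "compact (snd ` {(x, \<alpha>). x \<in> {\<pi>} \<and> \<alpha> \<in> BR v x})"
    by (intro compact_continuous_image compact_BR_graph continuous_intros) auto
  also have "snd ` {(x, \<alpha>). x \<in> {\<pi>} \<and> \<alpha> \<in> BR v x} = BR v \<pi>"
    by force
  finally have "\<exists>\<alpha>\<in>BR v \<pi>. \<forall>\<beta>\<in>BR v \<pi>. expected_payoff u \<beta> \<pi> \<le> expected_payoff u \<alpha> \<pi>"
    by (intro continuous_attains_sup BR_nonempty continuous_intros)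
  then obtain \<alpha> where \<alpha>: "\<alpha> \<in> BR v \<pi>" "\<forall>\<beta>\<in>BR v \<pi>. expected_payoff u \<beta> \<pi> \<le> expected_payoff u \<alpha> \<pi>"
    by blast
  then have "ubar u v \<pi> = expected_payoff u \<alpha> \<pi>"
    unfolding ubar_def by (intro Greatest_equality) auto
  with \<alpha> show ?thesis by blast
qed

section \<open>Deterring two types at once by connectedness\<close>

lemma unit_interval_closed_cover:
  fixes A B :: "real set"
  assumes "closed A" "closed B" "{0..1} \<subseteq> A \<union> B" "0 \<in> A" "1 \<in> B"
  shows "\<exists>x\<in>{0..1}. x \<in> A \<and> x \<in> B"
proof (rule ccontr)
  assume "\<not> ?thesis"
  then have "A \<inter> B \<inter> {0..1} = {}" by auto
  from connected_closedD[OF connected_Icc this assms(3,1,2)] assms(4,5) show False by auto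
qed

text \<open>
  \<open>r1\<close> and \<open>r2\<close> are the truthful payoffs at the posteriors \<open>\<pi>1\<close> and \<open>\<pi>2\<close>. By the hypothesis every
  best reply on the segment violates at most one of the two constraints, and at each end of the
  segment the constraint of that end holds. Connectedness is used twice: along the segment, and then
  within the best replies to a single belief.
\<close>

lemma deterring_action:
  fixes u v :: "'a::finite \<Rightarrow> 'w::finite \<Rightarrow> real"
  defines "P \<equiv> \<lambda>\<pi>1 \<pi>2 p. (1 - p) *\<^sub>R \<pi>1 + p *\<^sub>R (\<pi>2 :: real ^ 'w)"
  assumes le: "\<And>p \<alpha>. p \<in> {0..1} \<Longrightarrow> \<alpha> \<in> BR v (P \<pi>1 \<pi>2 p) \<Longrightarrow>
     expected_payoff u \<alpha> (P \<pi>1 \<pi>2 p) \<le> (1 - p) * r1 + p * r2"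
  shows "\<exists>\<pi>\<in>convex hull {\<pi>1, \<pi>2}. \<exists>\<alpha>\<in>BR v \<pi>. expected_payoff u \<alpha> \<pi>1 \<le> r1 \<and> expected_payoff u \<alpha> \<pi>2 \<le> r2"
proof -
  have dich: "expected_payoff u \<alpha> \<pi>1 \<le> r1 \<or> expected_payoff u \<alpha> \<pi>2 \<le> r2"
    if "p \<in> {0..1}" "\<alpha> \<in> BR v (P \<pi>1 \<pi>2 p)" for p \<alpha>
  proof (rule ccontr)
    assume "\<not> ?thesis"
    then have *: "r1 < expected_payoff u \<alpha> \<pi>1" "r2 < expected_payoff u \<alpha> \<pi>2" by auto
    have "(1 - p) * r1 + p * r2 < (1 - p) * expected_payoff u \<alpha> \<pi>1 + p * expected_payoff u \<alpha> \<pi>2"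
    \<comment> \<open>For positive \<open>p\<close> the second strict inequality carries positive
      weight; at \<open>p = 0\<close> only the first one counts.\<close>
    proof (cases "p = 0")
      case False
      then show ?thesis
        using * that(1) by (intro add_le_less_mono mult_left_mono mult_strict_left_mono) auto
    qed (use * in auto)
    with le[OF that] show False
      by (simp add: P_def expected_payoff_linear)
  qed
  define F where "F = (\<lambda>\<pi> r. {p \<in> {0..1}. \<exists>\<alpha>\<in>BR v (P \<pi>1 \<pi>2 p). expected_payoff u \<alpha> \<pi> \<le> r})"
  have "closed (F \<pi> r)" for \<pi> r
  proof -
    \<comment> \<open>Projections of closed sets need not be closed, so closedness is obtained by
      projecting a compact part of the best-reply graph.\<close>
    have "compact (fst ` ({(p, \<alpha>). p \<in> {0..1} \<and> \<alpha> \<in> BR v (P \<pi>1 \<pi>2 p)} \<inter>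
        {z. expected_payoff u (snd z) \<pi> \<le> r}))"
      unfolding P_def
      by (intro compact_continuous_image compact_Int_closed compact_BR_graph closed_Collect_le
          continuous_intros compact_Icc)
    also have "fst ` ({(p, \<alpha>). p \<in> {0..1} \<and> \<alpha> \<in> BR v (P \<pi>1 \<pi>2 p)} \<inter>
        {z. expected_payoff u (snd z) \<pi> \<le> r}) = F \<pi> r"
      by (force simp: F_def)
    finally show ?thesis by (rule compact_imp_closed)
  qed
  moreover have "0 \<in> F \<pi>1 r1" "1 \<in> F \<pi>2 r2"
    using le[of 0] le[of 1] BR_nonempty[of v \<pi>1] BR_nonempty[of v \<pi>2] by (auto simp: F_def P_def)
  moreover have "{0..1} \<subseteq> F \<pi>1 r1 \<union> F \<pi>2 r2"
    using dich BR_nonempty by (fastforce simp: F_def)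
  ultimately obtain p where "p \<in> {0..1}" "p \<in> F \<pi>1 r1" "p \<in> F \<pi>2 r2"
    using unit_interval_closed_cover by meson
  then obtain \<alpha> \<beta> where p: "p \<in> {0..1}"
    and \<alpha>: "\<alpha> \<in> BR v (P \<pi>1 \<pi>2 p)" "expected_payoff u \<alpha> \<pi>1 \<le> r1"
    and \<beta>: "\<beta> \<in> BR v (P \<pi>1 \<pi>2 p)" "expected_payoff u \<beta> \<pi>2 \<le> r2"
    by (auto simp: F_def)
  \<comment> \<open>The belief is now fixed. Mixing from \<alpha> to \<beta> stays within its best
    replies, so \<open>dich\<close> applies to every mixture.\<close>
  have br: "(1 - q) *\<^sub>R \<alpha> + q *\<^sub>R \<beta> \<in> BR v (P \<pi>1 \<pi>2 p)" if "q \<in> {0..1}" for q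
    using convexD[OF convex_BR \<alpha>(1) \<beta>(1)] that by auto
  have "\<exists>q\<in>{0..1}. q \<in> {q. expected_payoff u ((1 - q) *\<^sub>R \<alpha> + q *\<^sub>R \<beta>) \<pi>1 \<le> r1} \<and>
      q \<in> {q. expected_payoff u ((1 - q) *\<^sub>R \<alpha> + q *\<^sub>R \<beta>) \<pi>2 \<le> r2}"
    using \<alpha>(2) \<beta>(2) dich[OF p br]
    by (intro unit_interval_closed_cover closed_Collect_le continuous_intros subsetI) auto
  then obtain q where "q \<in> {0..1}" "expected_payoff u ((1 - q) *\<^sub>R \<alpha> + q *\<^sub>R \<beta>) \<pi>1 \<le> r1"
    "expected_payoff u ((1 - q) *\<^sub>R \<alpha> + q *\<^sub>R \<beta>) \<pi>2 \<le> r2" by auto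
  moreover have "P \<pi>1 \<pi>2 p \<in> convex hull {\<pi>1, \<pi>2}"
    using p by (auto simp: P_def convex_hull_2_alt algebra_simps intro!: exI[of _ p])
  ultimately show ?thesis using br by blast
qed

section \<open>Optimal splittings of the prior\<close>

text \<open>All best-reply payoffs are kept, not only the largest one: this set is compact, whereas
  \<open>ubar\<close> may jump and its graph need not be closed.\<close>

definition payoff_graph ::
  "('a::finite \<Rightarrow> 'w::finite \<Rightarrow> real) \<Rightarrow> ('a \<Rightarrow> 'w \<Rightarrow> real) \<Rightarrow> ((real ^ 'w) \<times> real) set" where
  "payoff_graph u v = (\<lambda>(\<pi>, \<alpha>). (\<pi>, expected_payoff u \<alpha> \<pi>)) ` {(\<pi>, \<alpha>). \<pi> \<in> prob_simplex \<and> \<alpha> \<in> BR v \<pi>}"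

lemma payoff_graph_iff:
  "(\<pi>, r) \<in> payoff_graph u v \<longleftrightarrow> \<pi> \<in> prob_simplex \<and> (\<exists>\<alpha>\<in>BR v \<pi>. r = expected_payoff u \<alpha> \<pi>)"
  by (auto simp: payoff_graph_def)

lemma compact_payoff_graph: "compact (payoff_graph u v)"
  unfolding payoff_graph_def case_prod_beta'
  by (intro compact_continuous_image continuous_intros
      compact_BR_graph[unfolded case_prod_beta'] compact_prob_simplex)

lemma payoff_graph_le_ubar: "z \<in> payoff_graph u v \<Longrightarrow> snd z \<le> ubar u v (fst z)"
  using ubar_attained[of v "fst z" u] by (cases z) (auto simp: payoff_graph_iff)

lemma ubar_in_payoff_graph: "\<pi> \<in> prob_simplex \<Longrightarrow> (\<pi>, ubar u v \<pi>) \<in> payoff_graph u v"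
  using ubar_attained[of v \<pi> u] by (auto simp: payoff_graph_iff)

text \<open>The region below a concave \<open>g\<close> over the simplex is convex and contains the
  payoff graph, hence also its convex hull.\<close>

lemma concave_majorant_convex_hull:
  assumes "g \<in> concave_majorants (ubar u v)" "z \<in> convex hull payoff_graph u v"
  shows "snd z \<le> g (fst z)"
proof -
  let ?H = "{z. fst z \<in> prob_simplex \<and> snd z \<le> g (fst z)}"
  have "convex ?H"
  proof (rule convexI)
    fix x y and s t :: real
    assume xy: "x \<in> ?H" "y \<in> ?H" and st: "0 \<le> s" "0 \<le> t" "s + t = 1"
    have "s * snd x + t * snd y \<le> s * g (fst x) + t * g (fst y)"
      using xy st by (intro add_mono mult_left_mono) auto
    also have "\<dots> \<le> g (s *\<^sub>R fst x + t *\<^sub>R fst y)"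
      using assms(1) xy st by (auto simp: concave_majorants_def concave_on_iff)
    finally show "s *\<^sub>R x + t *\<^sub>R y \<in> ?H"
      using xy st convexD[OF convex_prob_simplex] by auto
  qed
  moreover have "payoff_graph u v \<subseteq> ?H"
    using payoff_graph_le_ubar assms(1)
    by (fastforce simp: concave_majorants_def payoff_graph_iff)
  ultimately show ?thesis
    using hull_minimal[of "payoff_graph u v" ?H convex] assms(2) by blast
qed

text \<open>The upper boundary of the hull is a concave majorant of \<open>ubar\<close>, and the
  preceding lemma puts it below every other one. So it is the concavification, and compactness makes
  the value attained.\<close>

lemma cav_ubar_greatest:
  fixes u v :: "'a::finite \<Rightarrow> 'w::finite \<Rightarrow> real"
  assumes "\<pi> \<in> prob_simplex"
  shows "(\<pi>, cav (ubar u v) \<pi>) \<in> convex hull payoff_graph u v"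
    and "(\<pi>, r) \<in> convex hull payoff_graph u v \<Longrightarrow> r \<le> cav (ubar u v) \<pi>"
proof -
  let ?C = "convex hull payoff_graph u v"
  have comp: "compact ?C"
    by (intro compact_convex_hull compact_payoff_graph)
  have "\<exists>r. (\<rho>, r) \<in> ?C \<and> (\<forall>r'. (\<rho>, r') \<in> ?C \<longrightarrow> r' \<le> r)" if "\<rho> \<in> prob_simplex" for \<rho>
  proof -
    \<comment> \<open>The vertical slice of the hull above \<rho> is compact and non-empty, so it
      has a highest point, which becomes \<open>g \<rho>\<close>.\<close>
    have "compact (?C \<inter> {z. fst z = \<rho>})"
      by (intro compact_Int_closed comp closed_Collect_eq continuous_intros)
    moreover have "(\<rho>, ubar u v \<rho>) \<in> ?C \<inter> {z. fst z = \<rho>}"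
      using ubar_in_payoff_graph[OF that] by (auto intro: hull_inc)
    ultimately have "\<exists>z\<in>?C \<inter> {z. fst z = \<rho>}. \<forall>z'\<in>?C \<inter> {z. fst z = \<rho>}. snd z' \<le> snd z"
      by (intro continuous_attains_sup continuous_intros) auto
    then show ?thesis by force
  qed
  then obtain g where g: "\<And>\<rho>. \<rho> \<in> prob_simplex \<Longrightarrow> (\<rho>, g \<rho>) \<in> ?C"
    and g_max: "\<And>\<rho> r. \<rho> \<in> prob_simplex \<Longrightarrow> (\<rho>, r) \<in> ?C \<Longrightarrow> r \<le> g \<rho>"
    by metis
  have "concave_on prob_simplex g"
    unfolding concave_on_iff
  proof (intro conjI ballI allI impI convex_prob_simplex)
    fix x y :: "real ^ 'w" and s t :: real
    assume xy: "x \<in> prob_simplex" "y \<in> prob_simplex" and st: "0 \<le> s" "0 \<le> t" "s + t = 1"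
    have "s *\<^sub>R (x, g x) + t *\<^sub>R (y, g y) \<in> ?C"
      using xy st g by (intro convexD[OF convex_convex_hull]) auto
    then show "s * g x + t * g y \<le> g (s *\<^sub>R x + t *\<^sub>R y)"
      using xy st convexD[OF convex_prob_simplex] by (intro g_max) auto
  qed
  moreover have "ubar u v \<rho> \<le> g \<rho>" if "\<rho> \<in> prob_simplex" for \<rho>
    using that ubar_in_payoff_graph[OF that] by (intro g_max) (auto intro: hull_inc)
  ultimately have maj: "g \<in> concave_majorants (ubar u v)"
    by (auto simp: concave_majorants_def)
  have lower: "g \<pi> \<le> h \<pi>" if "h \<in> concave_majorants (ubar u v)" for h
    using concave_majorant_convex_hull[OF that g[OF assms]] by simp
  have "cav (ubar u v) \<pi> = g \<pi>"
    unfolding cav_def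
    using maj lower by (intro antisym cINF_lower cINF_greatest) (auto simp: bdd_below_def)
  with g g_max assms show "(\<pi>, cav (ubar u v) \<pi>) \<in> ?C" "(\<pi>, r) \<in> ?C \<Longrightarrow> r \<le> cav (ubar u v) \<pi>"
    by auto
qed

text \<open>The highest point of the hull above \<pi> is a finite convex combination of points of
  the payoff graph; its weights are the probabilities of the signals to be constructed.\<close>

lemma optimal_splitting:
  assumes "\<pi> \<in> prob_simplex"
  obtains S l where "finite S" "S \<subseteq> payoff_graph u v" "\<And>z. z \<in> S \<Longrightarrow> (0::real) < l z" "sum l S = 1"
    "(\<Sum>z\<in>S. l z *\<^sub>R fst z) = \<pi>" "(\<Sum>z\<in>S. l z * snd z) = cav (ubar u v) \<pi>"
proof -
  from cav_ubar_greatest(1)[OF assms, of u v] obtain T l where T: "finite T" "T \<subseteq> payoff_graph u v"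
    "\<forall>z\<in>T. 0 \<le> l z" "sum l T = 1" "(\<Sum>z\<in>T. l z *\<^sub>R z) = (\<pi>, cav (ubar u v) \<pi>)"
    unfolding convex_hull_explicit by blast
  \<comment> \<open>Points of weight zero are dropped, so that every remaining point becomes a
    signal of positive probability.\<close>
  define S where "S = {z \<in> T. l z \<noteq> 0}"
  have S: "sum (\<lambda>z. l z *\<^sub>R f z) T = sum (\<lambda>z. l z *\<^sub>R f z) S" for f :: "_ \<Rightarrow> 'c::real_vector"
    using T(1) by (intro sum.mono_neutral_right) (auto simp: S_def)
  have "(\<Sum>z\<in>T. l z *\<^sub>R fst z) = \<pi>" "(\<Sum>z\<in>T. l z *\<^sub>R snd z) = cav (ubar u v) \<pi>"
    using arg_cong[OF T(5), of fst] arg_cong[OF T(5), of snd] by (simp_all add: fst_sum snd_sum)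
  moreover have "(\<Sum>z\<in>T. l z *\<^sub>R 1) = (1::real)"
    using T(4) by simp
  ultimately show ?thesis
    using T unfolding S by (intro that[of S l]) (force simp: S_def)+
qed

text \<open>
  Otherwise, moving a little weight from \<open>x\<close> and \<open>y\<close> to the point at
  \<open>(1 - p) x + p y\<close> would improve the splitting.
\<close>

lemma optimal_splitting_segment:
  assumes S: "finite S" "S \<subseteq> payoff_graph u v" "\<And>z. z \<in> S \<Longrightarrow> (0::real) < l z" "sum l S = 1"
    "(\<Sum>z\<in>S. l z *\<^sub>R fst z) = \<pi>" "(\<Sum>z\<in>S. l z * snd z) = cav (ubar u v) \<pi>" "\<pi> \<in> prob_simplex"
    and xy: "x \<in> S" "y \<in> S" and p: "p \<in> {0..1}"
    and r: "((1 - p) *\<^sub>R fst x + p *\<^sub>R fst y, r) \<in> payoff_graph u v"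
  shows "r \<le> (1 - p) * snd x + p * snd y"
proof -
  let ?C = "convex hull payoff_graph u v"
  define e where "e = min (l x) (l y) / 2"
  have e: "0 < e" "2 * e \<le> l x" "2 * e \<le> l y"
    using S(3) xy by (auto simp: e_def)
  \<comment> \<open>The two deductions are added up, which also covers \<open>x = y\<close>. In
    every case a point loses at most \<open>e\<close>, so the new weights stay non-negative.\<close>
  define l' where "l' = (\<lambda>z. l z - e * (of_bool (z = x) * (1 - p) + of_bool (z = y) * p))"
  have l': "(\<Sum>z\<in>S. l' z *\<^sub>R f z) = (\<Sum>z\<in>S. l z *\<^sub>R f z) - e *\<^sub>R ((1 - p) *\<^sub>R f x + p *\<^sub>R f y)"
    for f :: "_ \<Rightarrow> 'c::real_vector"
  proof -
    have "(\<Sum>z\<in>S. l' z *\<^sub>R f z) = (\<Sum>z\<in>S. l z *\<^sub>R f z -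
        ((if z = x then (e * (1 - p)) *\<^sub>R f z else 0) + (if z = y then (e * p) *\<^sub>R f z else 0)))"
      by (intro sum.cong) (auto simp: l'_def algebra_simps)
    then show ?thesis
      using S(1) xy by (simp add: sum_subtractf sum.distrib scaleR_add_right)
  qed
  have ge: "0 \<le> l' z" if "z \<in> S" for z
  proof -
    have "of_bool (z = x) * (1 - p) + of_bool (z = y) * p \<le> 1"
      using p by auto
    then have "e * (of_bool (z = x) * (1 - p) + of_bool (z = y) * p) \<le> e * 1"
      using e(1) by (intro mult_left_mono) auto
    moreover have "z = x \<or> z = y \<Longrightarrow> e \<le> l z"
      using e by auto
    ultimately show ?thesis
      using S(3)[OF that] by (cases "z = x \<or> z = y") (auto simp: l'_def)
  qed
  let ?z = "((1 - p) *\<^sub>R fst x + p *\<^sub>R fst y, r)"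
  \<comment> \<open>The new point may already belong to \<open>S\<close>. Indexing it by
    \<open>None\<close> and the old points by \<open>Some\<close> keeps the two weights
    apart.\<close>
  let ?w = "case_option e l'" and ?p = "case_option ?z (\<lambda>z. z)"
  have "(\<Sum>i\<in>insert None (Some ` S). ?w i *\<^sub>R ?p i) \<in> ?C"
  proof (rule convex_sum[OF _ convex_convex_hull])
    show "sum ?w (insert None (Some ` S)) = 1"
      using S(1,4) l'[of "\<lambda>_. 1::real"] by (simp add: sum.reindex)
    fix i assume "i \<in> insert None (Some ` S)"
    then consider "i = None" | z where "i = Some z" "z \<in> S" by blast
    then show "0 \<le> ?w i" "?p i \<in> ?C"
      using e(1) ge hull_inc[OF r, of convex] hull_inc[OF subsetD[OF S(2)], of _ convex]
      by (cases; simp)+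
  qed (use S(1) in simp)
  then have "e *\<^sub>R ?z + (\<Sum>z\<in>S. l' z *\<^sub>R z) \<in> ?C"
    using S(1) by (simp add: sum.reindex)
  \<comment> \<open>The perturbed combination still lies above \<pi>, so its height cannot exceed
    the concavification; the gain, a positive multiple of \<open>r\<close> minus the chord, is
    therefore at most zero.\<close>
  moreover have "e *\<^sub>R ?z + (\<Sum>z\<in>S. l' z *\<^sub>R z) =
      (\<pi>, cav (ubar u v) \<pi> + e * (r - ((1 - p) * snd x + p * snd y)))"
    using S(5,6) l'[of fst] l'[of snd]
    by (intro prod_eqI) (simp_all add: fst_sum snd_sum algebra_simps)
  ultimately have "e * (r - ((1 - p) * snd x + p * snd y)) \<le> 0"
    using cav_ubar_greatest(2)[OF S(7)] by fastforce
  then show ?thesis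
    using e(1) by (simp add: mult_le_0_iff)
qed

section \<open>Experiments\<close>

text \<open>Consecutive intervals of lengths \<open>q i\<close> are cut off from the left. All are
  half-open except the last, which closes the right end. The left end \<open>a\<close> varies in the
  induction because the inserted piece comes first and shifts the others.\<close>

lemma split_interval:
  fixes q :: "'i \<Rightarrow> real"
  assumes "finite I" "I \<noteq> {}" "\<And>i. i \<in> I \<Longrightarrow> 0 \<le> q i"
  shows "\<exists>A. (\<forall>i\<in>I. A i \<in> sets lebesgue \<and> measure lebesgue (A i) = q i) \<and>
    disjoint_family_on A I \<and> (\<Union>i\<in>I. A i) = {a..a + sum q I}"
  using assms
proof (induction arbitrary: a rule: finite_ne_induct)
  case (singleton i)
  then show ?case
    by (intro exI[of _ "\<lambda>_. {a..a + q i}"]) (auto simp: disjoint_family_on_def)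
next
  case (insert i I)
  from insert.IH[of "a + q i"] insert.prems obtain A where
    A: "\<forall>j\<in>I. A j \<in> sets lebesgue \<and> measure lebesgue (A j) = q j" "disjoint_family_on A I"
      "(\<Union>j\<in>I. A j) = {a + q i..a + q i + sum q I}" by auto
  have nonneg: "0 \<le> q i" "0 \<le> sum q I"
    using insert.prems by (auto intro: sum_nonneg)
  let ?A = "A(i := {a..<a + q i})"
  have upd: "?A j = A j" if "j \<in> I" for j
    using that insert.hyps by auto
  have sub: "A j \<subseteq> {a + q i..}" if "j \<in> I" for j
    using that A(3) by fastforce
  have "disjoint_family_on ?A (insert i I)"
    unfolding disjoint_family_on_insert[OF insert.hyps(3)]
  proof
    show "?A i \<inter> \<Union> (?A ` I) = {}"
      using sub insert.hyps(3) upd by (auto dest!: sub)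
    show "disjoint_family_on ?A I"
      using A(2) upd by (simp add: disjoint_family_on_def)
  qed
  moreover have "?A i = {a..<a + q i}"
    by simp
  moreover have "(\<Union>j\<in>insert i I. ?A j) = {a..<a + q i} \<union> (\<Union>j\<in>I. A j)"
    using upd by (simp cong: SUP_cong del: fun_upd_apply) (simp add: fun_upd_same)
  then have "(\<Union>j\<in>insert i I. ?A j) = {a..a + sum q (insert i I)}"
    using nonneg insert.hyps A(3) by (auto simp: add.assoc)
  ultimately show ?case
    using A(1) upd nonneg by (intro exI[of _ ?A]) (auto simp del: fun_upd_apply)
qed

section \<open>Posteriors and total probability\<close>

lemma event_prob_nonneg: "\<pi> \<in> prob_simplex \<Longrightarrow> 0 \<le> event_prob \<pi> E"
  by (auto simp: event_prob_def cond_prob_state_def prob_simplex_def intro!: sum_nonneg)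

text \<open>Clearing the denominator is safe for null events too: there every joint probability of
  state and event vanishes.\<close>

lemma event_prob_posterior:
  assumes "\<pi> \<in> prob_simplex"
  shows "event_prob \<pi> E * posterior \<pi> E $ w = \<pi> $ w * cond_prob_state E w"
proof (cases "event_prob \<pi> E = 0")
  case True
  then have "\<pi> $ w * cond_prob_state E w = 0"
    unfolding event_prob_def using assms
    by (subst (asm) sum_nonneg_eq_0_iff) (auto simp: prob_simplex_def cond_prob_state_def)
  with True show ?thesis by simp
qed (simp add: posterior_def)

lemma sets_section:
  "E \<in> sets (count_space UNIV \<Otimes>\<^sub>M lebesgue) \<Longrightarrow> {x. (w, x) \<in> E} \<in> sets lebesgue"
  using sets_Pair1[of E "count_space UNIV" lebesgue w] by (simp add: vimage_def)

text \<open>Law of total probability: the sections at \<open>w\<close> of the cells cut the section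
  of \<open>E\<close> into finitely many disjoint measurable pieces of finite measure.\<close>

lemma sum_cond_prob_state:
  assumes \<sigma>: "\<sigma> \<in> experiments"
    and E: "E \<in> sets (count_space UNIV \<Otimes>\<^sub>M lebesgue)" "E \<subseteq> UNIV \<times> {0..1}"
  shows "(\<Sum>s\<in>\<sigma>. cond_prob_state (E \<inter> s) w) = cond_prob_state E w"
proof -
  have part: "partition_on (UNIV \<times> {0..1}) \<sigma>" and fin: "finite \<sigma>"
    and sets: "\<And>s. s \<in> \<sigma> \<Longrightarrow> E \<inter> s \<in> sets (count_space UNIV \<Otimes>\<^sub>M lebesgue)"
    using \<sigma> E(1) by (auto simp: experiments_def)
  have "measure lebesgue (\<Union>s\<in>\<sigma>. {x. (w, x) \<in> E \<inter> s}) =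
      (\<Sum>s\<in>\<sigma>. measure lebesgue {x. (w, x) \<in> E \<inter> s})"
  proof (rule measure_finite_Union[OF fin])
    show "(\<lambda>s. {x. (w, x) \<in> E \<inter> s}) ` \<sigma> \<subseteq> sets lebesgue"
      using sets_section[OF sets] by auto
    show "disjoint_family_on (\<lambda>s. {x. (w, x) \<in> E \<inter> s}) \<sigma>"
      using partition_onD2[OF part] by (fastforce simp: disjoint_family_on_def disjoint_def)
    show "emeasure lebesgue {x. (w, x) \<in> E \<inter> s} \<noteq> \<infinity>" if "s \<in> \<sigma>" for s
    proof -
      have "emeasure lebesgue {x. (w, x) \<in> E \<inter> s} \<le> emeasure lebesgue {0..1::real}"
        using E(2) by (intro emeasure_mono) auto
      then show ?thesis
        by (auto simp: top_unique)
    qed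
  qed
  moreover have "(\<Union>s\<in>\<sigma>. {x. (w, x) \<in> E \<inter> s}) = {x. (w, x) \<in> E}"
    using E(2) partition_onD1[OF part] by fastforce
  ultimately show ?thesis
    by (simp add: cond_prob_state_def)
qed

lemma experiment_signalD:
  assumes "\<sigma> \<in> experiments" "s \<in> \<sigma>"
  shows "s \<in> sets (count_space UNIV \<Otimes>\<^sub>M lebesgue)" "s \<subseteq> UNIV \<times> {0..1}"
  using assms by (auto simp: experiments_def partition_on_def)

lemma sum_cond_prob_state_UNIV:
  fixes \<sigma> :: "'w::finite stat_experiment"
  assumes "\<sigma> \<in> experiments"
  shows "(\<Sum>s\<in>\<sigma>. cond_prob_state s w) = 1"
proof -
  let ?X = "UNIV \<times> {0..1} :: ('w \<times> real) set"
  have "?X \<in> sets (count_space UNIV \<Otimes>\<^sub>M lebesgue)"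
    by (intro pair_measureI) auto
  from sum_cond_prob_state[OF assms this, of w]
  have "(\<Sum>s\<in>\<sigma>. cond_prob_state (?X \<inter> s) w) = measure lebesgue {0..1::real}"
    by (simp add: cond_prob_state_def[of ?X] flip: atLeastAtMost_iff)
  then show ?thesis
    using experiment_signalD(2)[OF assms] by (simp add: Int_absorb1)
qed

lemma sum_cond_prob_state_pairs:
  assumes "\<sigma>1 \<in> experiments" "\<sigma>2 \<in> experiments"
  shows "(\<Sum>s1\<in>\<sigma>1. \<Sum>s2\<in>\<sigma>2. cond_prob_state (s1 \<inter> s2) w) = 1"
  using assms experiment_signalD[OF assms(1)]
  by (simp add: sum_cond_prob_state sum_cond_prob_state_UNIV)

text \<open>Distinct cells of one partition are disjoint, so only the diagonal term survives. This
  is how equal experiments give both experts the same signal.\<close>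

lemma sum_cond_prob_state_same:
  assumes "\<sigma> \<in> experiments" "s \<in> \<sigma>"
  shows "(\<Sum>s'\<in>\<sigma>. cond_prob_state (s \<inter> s') w * f s') = cond_prob_state s w * (f s :: real)"
proof -
  have fin: "finite \<sigma>" and disj: "\<And>s'. s' \<in> \<sigma> \<Longrightarrow> s' \<noteq> s \<Longrightarrow> s \<inter> s' = {}"
    using assms by (auto simp: experiments_def partition_on_def disjoint_def)
  have "(\<Sum>s'\<in>\<sigma>. cond_prob_state (s \<inter> s') w * f s') =
      (\<Sum>s'\<in>\<sigma>. if s' = s then cond_prob_state s w * f s else 0)"
    using disj by (intro sum.cong) (simp_all add: cond_prob_state_def del: Int_iff)
  then show ?thesis
    using fin assms(2) by simp
qed

text \<open>Posteriors average back to the prior under the probabilities of the signal pairs. This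
  makes the prior an admissible belief after unexpected messages.\<close>

lemma prior_in_posterior_hull:
  assumes \<pi>: "\<pi> \<in> prob_simplex" and \<sigma>: "\<sigma>1 \<in> experiments" "\<sigma>2 \<in> experiments"
  shows "\<pi> \<in> convex hull
    {posterior \<pi> (s1 \<inter> s2) | s1 s2. s1 \<in> \<sigma>1 \<and> s2 \<in> \<sigma>2 \<and> event_prob \<pi> (s1 \<inter> s2) > 0}"
    (is "_ \<in> convex hull ?P")
proof -
  \<comment> \<open>Only pairs of positive probability contribute admissible posteriors; the others
    have weight zero, so the averages do not change.\<close>
  define T where "T = {(s1, s2). s1 \<in> \<sigma>1 \<and> s2 \<in> \<sigma>2 \<and> event_prob \<pi> (s1 \<inter> s2) > 0}"
  have fin: "finite (\<sigma>1 \<times> \<sigma>2)"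
    using \<sigma> by (auto simp: experiments_def)
  have T: "T \<subseteq> \<sigma>1 \<times> \<sigma>2" "finite T"
    using finite_subset[OF _ fin, of T] by (auto simp: T_def)
  have sum_T: "(\<Sum>(s1, s2)\<in>T. event_prob \<pi> (s1 \<inter> s2) * posterior \<pi> (s1 \<inter> s2) $ w) = \<pi> $ w" for w
  proof -
    have "(\<Sum>(s1, s2)\<in>T. event_prob \<pi> (s1 \<inter> s2) * posterior \<pi> (s1 \<inter> s2) $ w) =
        (\<Sum>(s1, s2)\<in>\<sigma>1 \<times> \<sigma>2. event_prob \<pi> (s1 \<inter> s2) * posterior \<pi> (s1 \<inter> s2) $ w)"
      using event_prob_nonneg[OF \<pi>] T(1)
      by (intro sum.mono_neutral_left fin) (auto simp: T_def order_less_le)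
    also have "\<dots> = \<pi> $ w * (\<Sum>s1\<in>\<sigma>1. \<Sum>s2\<in>\<sigma>2. cond_prob_state (s1 \<inter> s2) w)"
      by (simp add: event_prob_posterior[OF \<pi>] sum.cartesian_product[symmetric] sum_distrib_left)
    finally show ?thesis
      by (simp add: sum_cond_prob_state_pairs[OF \<sigma>])
  qed
  have post: "(\<Sum>w\<in>UNIV. posterior \<pi> E $ w) = 1" if "event_prob \<pi> E > 0" for E
    using that unfolding posterior_def by (simp add: event_prob_def flip: sum_divide_distrib)
  have "(\<Sum>p\<in>T. event_prob \<pi> (fst p \<inter> snd p)) =
      (\<Sum>p\<in>T. \<Sum>w\<in>UNIV. event_prob \<pi> (fst p \<inter> snd p) * posterior \<pi> (fst p \<inter> snd p) $ w)"
    using post by (intro sum.cong) (auto simp: T_def simp flip: sum_distrib_left)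
  also have "\<dots> = (\<Sum>w\<in>UNIV. \<pi> $ w)"
    by (subst sum.swap) (simp add: sum_T[unfolded case_prod_beta'])
  also have "\<dots> = 1"
    using \<pi> by (simp add: prob_simplex_def)
  finally have one: "(\<Sum>p\<in>T. event_prob \<pi> (fst p \<inter> snd p)) = 1" .
  have "posterior \<pi> (fst p \<inter> snd p) \<in> convex hull ?P" if "p \<in> T" for p
    using that by (intro hull_inc) (simp add: T_def case_prod_beta', blast)
  then have "(\<Sum>p\<in>T. event_prob \<pi> (fst p \<inter> snd p) *\<^sub>R posterior \<pi> (fst p \<inter> snd p)) \<in> convex hull ?P"
    by (intro convex_sum convex_convex_hull T(2) one event_prob_nonneg \<pi>)
  also have "(\<Sum>p\<in>T. event_prob \<pi> (fst p \<inter> snd p) *\<^sub>R posterior \<pi> (fst p \<inter> snd p)) = \<pi>"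
    by (simp add: vec_eq_iff sum_T[unfolded case_prod_beta'])
  finally show ?thesis .
qed

text \<open>Splitting lemma: by Bayes' rule signal \<open>i\<close> must have probability
  \<open>l i * P i $ w / \<pi> $ w\<close> in state \<open>w\<close>, and in each state the unit
  interval is cut into pieces of these lengths.\<close>

lemma splitting_experiment:
  fixes P :: "'i \<Rightarrow> real ^ 'w::finite"
  assumes I: "finite I" and l: "\<And>i. i \<in> I \<Longrightarrow> 0 < l i" "sum l I = 1"
    and P: "\<And>i. i \<in> I \<Longrightarrow> P i \<in> prob_simplex" "(\<Sum>i\<in>I. l i *\<^sub>R P i) = \<pi>"
  obtains f where "inj_on f I" "f ` I \<in> experiments"
    "\<And>i. i \<in> I \<Longrightarrow> event_prob \<pi> (f i) = l i" "\<And>i. i \<in> I \<Longrightarrow> posterior \<pi> (f i) = P i"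
proof -
  have \<pi>_eq: "\<pi> $ w = (\<Sum>i\<in>I. l i * P i $ w)" for w
    by (simp flip: P(2))
  have nonneg: "0 \<le> l i * P i $ w" if "i \<in> I" for i w
    using l(1) prob_simplexD(1)[OF P(1)] that by (simp add: less_imp_le)
  \<comment> \<open>In a state of prior probability zero the quotient is meaningless; the weights
    \<open>l\<close> are used there, since they also sum to one and do not affect any
    posterior.\<close>
  define q where "q = (\<lambda>w i. if \<pi> $ w = 0 then l i else l i * P i $ w / \<pi> $ w)"
  define splits where "splits = (\<lambda>w A. (\<forall>i\<in>I. A i \<in> sets lebesgue \<and> measure lebesgue (A i) = q w i) \<and>
      disjoint_family_on A I \<and> (\<Union>i\<in>I. A i) = {0..1::real})"
  have "\<exists>A. splits w A" for w
  proof -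
    have "sum (q w) I = 1"
      using l(2) \<pi>_eq[of w] by (cases "\<pi> $ w = 0") (simp_all add: q_def flip: sum_divide_distrib)
    moreover have "0 \<le> q w i" if "i \<in> I" for i
      using nonneg l(1)[OF that] that by (auto simp: q_def \<pi>_eq sum_nonneg less_imp_le)
    moreover have "I \<noteq> {}"
      using l(2) by auto
    ultimately show ?thesis
      using split_interval[OF I, of "q w" 0] by (simp add: splits_def)
  qed
  then obtain A where "\<And>w. splits w (A w)"
    by metis
  then have A: "\<And>w i. i \<in> I \<Longrightarrow> A w i \<in> sets lebesgue"
    "\<And>w i. i \<in> I \<Longrightarrow> measure lebesgue (A w i) = q w i"
    "\<And>w. disjoint_family_on (A w) I" "\<And>w. (\<Union>i\<in>I. A w i) = {0..1}"
    by (simp_all add: splits_def)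
  define f where "f = (\<lambda>i. {(w, x). x \<in> A w i})"
  have cond: "\<pi> $ w * cond_prob_state (f i) w = l i * P i $ w" if "i \<in> I" for i w
  proof (cases "\<pi> $ w = 0")
    case True
    then have "l i * P i $ w = 0"
      using sum_nonneg_eq_0_iff[OF I, of "\<lambda>i. l i * P i $ w"] nonneg that by (simp add: \<pi>_eq)
    with True show ?thesis by simp
  next
    case False
    with that show ?thesis
      by (simp add: cond_prob_state_def f_def A(2) q_def)
  qed
  have ev: "event_prob \<pi> (f i) = l i" if "i \<in> I" for i
    using prob_simplexD(2)[OF P(1)[OF that]]
    by (simp add: event_prob_def cond[OF that] flip: sum_distrib_left)
  have post: "posterior \<pi> (f i) = P i" if "i \<in> I" for i
    using l(1)[OF that] by (simp add: posterior_def cond[OF that] ev[OF that] vec_eq_iff)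
  have disj: "f i \<inter> f j = {}" if "i \<in> I" "j \<in> I" "i \<noteq> j" for i j
    using disjoint_family_onD[OF A(3) that] by (auto simp: f_def)
  have ne: "f i \<noteq> {}" if "i \<in> I" for i
    using l(1)[OF that] ev[OF that] by (auto simp: event_prob_def cond_prob_state_def)
  have "inj_on f I"
    using disj ne by (intro inj_onI) (metis inf.idem)
  moreover have "f ` I \<in> experiments"
    unfolding experiments_def
  proof (intro CollectI conjI)
    show "partition_on (UNIV \<times> {0..1}) (f ` I)"
    proof (rule partition_onI)
      show "\<Union> (f ` I) = UNIV \<times> {0..1}"
        using A(4) by (auto simp: f_def)
      show "disjnt p q" if "p \<in> f ` I" "q \<in> f ` I" "p \<noteq> q" for p q
        using that disj by (auto simp: disjnt_def)
      show "{} \<notin> f ` I"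
        using ne by force
    qed
    show "f ` I \<subseteq> sets (count_space UNIV \<Otimes>\<^sub>M lebesgue)"
    proof (rule image_subsetI)
      fix i assume "i \<in> I"
      then have "(\<Union>w\<in>UNIV. {w} \<times> A w i) \<in> sets (count_space UNIV \<Otimes>\<^sub>M lebesgue)"
        using A(1) by (intro sets.finite_UN pair_measureI) auto
      also have "(\<Union>w\<in>UNIV. {w} \<times> A w i) = f i"
        by (auto simp: f_def)
      finally show "f i \<in> sets (count_space UNIV \<Otimes>\<^sub>M lebesgue)" .
    qed
  qed (use I in auto)
  ultimately show ?thesis
    using ev post that by blast
qed

text \<open>Turns an optimal splitting into signals, with \<open>r s\<close> the payoff promised
  after \<open>s\<close>. The last conclusion supplies the punishment for disagreeing
  reports.\<close>

lemma commitment_experiment: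
  fixes u v :: "'a::finite \<Rightarrow> 'w::finite \<Rightarrow> real"
  assumes \<pi>: "\<pi> \<in> prob_simplex"
  obtains \<sigma> r where "\<sigma> \<in> experiments" "\<And>s. s \<in> \<sigma> \<Longrightarrow> event_prob \<pi> s > 0"
    "(\<Sum>s\<in>\<sigma>. event_prob \<pi> s * r s) = cav (ubar u v) \<pi>"
    "\<And>s. s \<in> \<sigma> \<Longrightarrow> \<exists>\<alpha>\<in>BR v (posterior \<pi> s). expected_payoff u \<alpha> (posterior \<pi> s) = r s"
    "\<And>s t. s \<in> \<sigma> \<Longrightarrow> t \<in> \<sigma> \<Longrightarrow>
      \<exists>\<rho>\<in>convex hull {posterior \<pi> s, posterior \<pi> t}. \<exists>\<alpha>\<in>BR v \<rho>.
        expected_payoff u \<alpha> (posterior \<pi> s) \<le> r s \<and> expected_payoff u \<alpha> (posterior \<pi> t) \<le> r t"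
proof -
  obtain S l where
    S: "finite S" "S \<subseteq> payoff_graph u v" "\<And>z. z \<in> S \<Longrightarrow> (0::real) < l z" "sum l S = 1"
      "(\<Sum>z\<in>S. l z *\<^sub>R fst z) = \<pi>" "(\<Sum>z\<in>S. l z * snd z) = cav (ubar u v) \<pi>"
    by (rule optimal_splitting[OF \<pi>, of u v]) (rule that; assumption)
  have graph: "fst z \<in> prob_simplex" "\<exists>\<alpha>\<in>BR v (fst z). snd z = expected_payoff u \<alpha> (fst z)"
    if "z \<in> S" for z
    using subsetD[OF S(2) that] by (cases z; simp add: payoff_graph_iff)+
  obtain f where
    f: "inj_on f S" "f ` S \<in> experiments" "\<And>z. z \<in> S \<Longrightarrow> event_prob \<pi> (f z) = l z"
      "\<And>z. z \<in> S \<Longrightarrow> posterior \<pi> (f z) = fst z"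
    by (rule splitting_experiment[OF S(1) S(3,4) graph(1) S(5)]; (assumption | rule that; assumption))
  \<comment> \<open>The promise is attached to the signal, not to its posterior: two points of
    \<open>S\<close> may share a belief and differ in payoff.\<close>
  define r where "r = (\<lambda>s. snd (inv_into S f s))"
  have r: "r (f z) = snd z" if "z \<in> S" for z
    using f(1) that by (simp add: r_def)
  have pair: "\<exists>\<rho>\<in>convex hull {fst x, fst y}. \<exists>\<alpha>\<in>BR v \<rho>.
      expected_payoff u \<alpha> (fst x) \<le> snd x \<and> expected_payoff u \<alpha> (fst y) \<le> snd y"
    if xy: "x \<in> S" "y \<in> S" for x y
  proof (rule deterring_action)
    fix p :: real and \<alpha>
    assume p: "p \<in> {0..1}" and \<alpha>: "\<alpha> \<in> BR v ((1 - p) *\<^sub>R fst x + p *\<^sub>R fst y)"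
    have "(1 - p) *\<^sub>R fst x + p *\<^sub>R fst y \<in> prob_simplex"
      using p graph(1) xy by (intro convexD[OF convex_prob_simplex]) auto
    with p \<alpha> show "expected_payoff u \<alpha> ((1 - p) *\<^sub>R fst x + p *\<^sub>R fst y) \<le> (1 - p) * snd x + p * snd y"
      by (intro optimal_splitting_segment[OF S \<pi> xy]) (auto simp: payoff_graph_iff)
  qed
  show ?thesis
  proof (rule that[OF f(2), of r])
    show "(\<Sum>s\<in>f ` S. event_prob \<pi> s * r s) = cav (ubar u v) \<pi>"
      using S(6) f r by (simp add: sum.reindex)
    fix s assume "s \<in> f ` S"
    then obtain x where x: "s = f x" "x \<in> S" ..
    then show "event_prob \<pi> s > 0"
      by (simp add: f(3) S(3))
    show "\<exists>\<alpha>\<in>BR v (posterior \<pi> s). expected_payoff u \<alpha> (posterior \<pi> s) = r s"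
      using graph(2)[OF x(2)] by (auto simp: f(4) r x)
    fix t assume "t \<in> f ` S"
    then obtain y where y: "t = f y" "y \<in> S" ..
    show "\<exists>\<rho>\<in>convex hull {posterior \<pi> s, posterior \<pi> t}. \<exists>\<alpha>\<in>BR v \<rho>.
        expected_payoff u \<alpha> (posterior \<pi> s) \<le> r s \<and> expected_payoff u \<alpha> (posterior \<pi> t) \<le> r t"
      using pair[OF x(2) y(2)] by (simp add: f(4) r x y)
  qed
qed

section \<open>Babbling sub-games\<close>

lemma babbling_msg_prob_state:
  assumes "\<sigma>1 \<in> experiments" "\<sigma>2 \<in> experiments"
  shows "msg_prob_state \<sigma>1 \<sigma>2 (\<lambda>_. \<mu>) (\<lambda>_. \<nu>) m n w = pmf \<mu> m * pmf \<nu> n"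
  unfolding msg_prob_state_def sum_distrib_right[symmetric] sum_cond_prob_state_pairs[OF assms] by simp

text \<open>Messages that do not depend on the signal carry no information, so Bayes' rule returns
  the prior; after message pairs of probability zero the prior is admissible as an average of
  posteriors.\<close>

lemma babbling_consistent:
  assumes \<pi>: "\<pi> \<in> prob_simplex" and \<sigma>: "\<sigma>1 \<in> experiments" "\<sigma>2 \<in> experiments"
  shows "consistent_beliefs \<pi> \<sigma>1 \<sigma>2 (\<lambda>_. \<mu>) (\<lambda>_. \<nu>) (\<lambda>_ _. \<pi>)"
proof -
  have prob: "msg_prob \<pi> \<sigma>1 \<sigma>2 (\<lambda>_. \<mu>) (\<lambda>_. \<nu>) m n = pmf \<mu> m * pmf \<nu> n" for m n
    using prob_simplexD(2)[OF \<pi>]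
    by (simp add: msg_prob_def babbling_msg_prob_state[OF \<sigma>] flip: sum_distrib_right)
  show ?thesis
    unfolding consistent_beliefs_def
    using prior_in_posterior_hull[OF \<pi> \<sigma>]
    by (auto simp: prob bayes_belief_def babbling_msg_prob_state[OF \<sigma>] vec_eq_iff)
qed

lemma babbling_optimal_messages: "optimal_messages u \<pi> \<sigma> \<sigma>' t t' (\<lambda>_ _. \<alpha>)"
  by (simp add: optimal_messages_def interim_payoff_def)

lemma babbling_payoff:
  assumes \<sigma>: "\<sigma>1 \<in> experiments" "\<sigma>2 \<in> experiments"
    and E: "act E \<sigma>1 \<sigma>2 = (\<lambda>_ _. \<alpha>)"
  shows "subgame_payoff u \<pi> E \<sigma>1 \<sigma>2 = expected_payoff u \<alpha> \<pi>"
proof -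
  have "subgame_payoff u \<pi> E \<sigma>1 \<sigma>2 = (\<Sum>w\<in>UNIV. \<pi> $ w *
      (\<Sum>s1\<in>\<sigma>1. \<Sum>s2\<in>\<sigma>2. cond_prob_state (s1 \<inter> s2) w) * expected_payoff u \<alpha> (axis w 1))"
    by (simp add: subgame_payoff_def E sum_distrib_left sum_distrib_right)
  then show ?thesis
    by (simp add: sum_cond_prob_state_pairs[OF \<sigma>] sum_expected_payoff_axis)
qed

section \<open>Truthful sub-games\<close>

text \<open>Only message pairs encoding one common signal have positive probability, and injectivity
  identifies that signal. After all other pairs the hull condition suffices.\<close>

lemma truthful_consistent:
  assumes \<pi>: "\<pi> \<in> prob_simplex" and \<sigma>: "\<sigma> \<in> experiments"
    and inj: "inj_on e1 \<sigma>" "inj_on e2 \<sigma>"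
    and on_path: "\<And>s. s \<in> \<sigma> \<Longrightarrow> b (e1 s) (e2 s) = posterior \<pi> s"
    and hull: "\<And>m n. b m n \<in> convex hull (posterior \<pi> ` {s \<in> \<sigma>. event_prob \<pi> s > 0})"
  shows "consistent_beliefs \<pi> \<sigma> \<sigma> (\<lambda>s. return_pmf (e1 s)) (\<lambda>s. return_pmf (e2 s)) b"
proof -
  let ?q = "msg_prob_state \<sigma> \<sigma> (\<lambda>s. return_pmf (e1 s)) (\<lambda>s. return_pmf (e2 s))"
  have fin: "finite \<sigma>"
    using \<sigma> by (simp add: experiments_def)
  have q: "?q m n w = (\<Sum>s\<in>\<sigma>. cond_prob_state s w * (pmf (return_pmf (e1 s)) m * pmf (return_pmf (e2 s)) n))"
    for m n w
    unfolding msg_prob_state_def mult.assoc by (intro sum.cong refl sum_cond_prob_state_same \<sigma>)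
  have q_path: "?q (e1 s) (e2 s) w = cond_prob_state s w" if "s \<in> \<sigma>" for s w
  proof -
    have "?q (e1 s) (e2 s) w = (\<Sum>t\<in>\<sigma>. if t = s then cond_prob_state t w else 0)"
      unfolding q using inj that by (intro sum.cong) (auto simp: inj_on_def indicator_def)
    then show ?thesis
      using fin that by simp
  qed
  have off: "?q m n w = 0" if "\<nexists>s. s \<in> \<sigma> \<and> m = e1 s \<and> n = e2 s" for m n w
    unfolding q using that by (intro sum.neutral) (auto simp: indicator_def)
  have "b m n = bayes_belief \<pi> \<sigma> \<sigma> (\<lambda>s. return_pmf (e1 s)) (\<lambda>s. return_pmf (e2 s)) m n"
    if "msg_prob \<pi> \<sigma> \<sigma> (\<lambda>s. return_pmf (e1 s)) (\<lambda>s. return_pmf (e2 s)) m n > 0" for m n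
  proof -
    have "\<exists>s. s \<in> \<sigma> \<and> m = e1 s \<and> n = e2 s"
    proof (rule ccontr)
      assume "\<not> ?thesis"
      with that show False by (simp add: msg_prob_def off)
    qed
    then obtain s where s: "s \<in> \<sigma>" "m = e1 s" "n = e2 s" by blast
    then show ?thesis
      using on_path[OF s(1)]
      by (simp add: bayes_belief_def msg_prob_def q_path posterior_def event_prob_def)
  qed
  \<comment> \<open>The diagonal pairs \<open>s \<inter> s = s\<close> already provide all
    single-signal posteriors.\<close>
  moreover have "posterior \<pi> ` {s \<in> \<sigma>. event_prob \<pi> s > 0} \<subseteq>
      {posterior \<pi> (s1 \<inter> s2) | s1 s2. s1 \<in> \<sigma> \<and> s2 \<in> \<sigma> \<and> event_prob \<pi> (s1 \<inter> s2) > 0}"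
  proof safe
    fix s assume "s \<in> \<sigma>" "event_prob \<pi> s > 0"
    then show "\<exists>s1 s2. posterior \<pi> s = posterior \<pi> (s1 \<inter> s2) \<and> s1 \<in> \<sigma> \<and> s2 \<in> \<sigma> \<and>
        event_prob \<pi> (s1 \<inter> s2) > 0"
      by (intro exI[of _ s]) simp
  qed
  ultimately show ?thesis
    unfolding consistent_beliefs_def using hull hull_mono by (metis (no_types, lifting) subsetD)
qed

text \<open>The other expert saw the same signal and reports it, so the only remaining uncertainty
  is about the state, with law \<open>posterior \<pi> s\<close>, and the own message.\<close>

lemma truthful_interim_payoff:
  assumes "\<sigma> \<in> experiments" "s \<in> \<sigma>"
  shows "interim_payoff u \<pi> \<sigma> (\<lambda>s. return_pmf (e s)) c s \<mu> =
    (\<Sum>w\<in>UNIV. posterior \<pi> s $ w *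
      measure_pmf.expectation \<mu> (\<lambda>m. expected_payoff u (c m (e s)) (axis w 1)))"
proof -
  have "interim_payoff u \<pi> \<sigma> (\<lambda>s. return_pmf (e s)) c s \<mu> =
      (\<Sum>w\<in>UNIV. \<pi> $ w / event_prob \<pi> s * (\<Sum>s'\<in>\<sigma>. cond_prob_state (s \<inter> s') w *
        measure_pmf.expectation \<mu> (\<lambda>m. expected_payoff u (c m (e s')) (axis w 1))))"
    by (simp add: interim_payoff_def sum_distrib_left mult_ac)
  then show ?thesis
    by (simp add: sum_cond_prob_state_same[OF assms] posterior_def mult_ac)
qed

text \<open>Message distributions may have infinite support; this bound, uniform in the action,
  makes their expected payoffs integrable.\<close>

lemma expected_payoff_axis_bounded:
  assumes "\<alpha> \<in> prob_simplex"
  shows "\<bar>expected_payoff u \<alpha> (axis w 1)\<bar> \<le> (\<Sum>a\<in>UNIV. \<bar>u a w\<bar>)"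
  unfolding expected_payoff_axis
proof (rule order_trans[OF sum_abs sum_mono])
  show "\<bar>\<alpha> $ a * u a w\<bar> \<le> \<bar>u a w\<bar>" for a
    using prob_simplexD(1)[OF assms] prob_simplex_le_1[OF assms]
    by (simp add: abs_mult mult_left_le_one_le)
qed

text \<open>Pure misreports are enough to check: the payoff of a mixed message is an average of
  payoffs that are each at most the truthful one.\<close>

lemma truthful_optimal_messages:
  fixes c :: "'m \<Rightarrow> 'n \<Rightarrow> real ^ 'a::finite"
  assumes \<sigma>: "\<sigma> \<in> experiments"
    and c: "\<And>m n. c m n \<in> prob_simplex"
    and opt: "\<And>s m. s \<in> \<sigma> \<Longrightarrow> expected_payoff u (c m (e' s)) (posterior \<pi> s) \<le>
      expected_payoff u (c (e s) (e' s)) (posterior \<pi> s)"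
  shows "optimal_messages u \<pi> \<sigma> \<sigma> (\<lambda>s. return_pmf (e s)) (\<lambda>s. return_pmf (e' s)) c"
  unfolding optimal_messages_def
proof (intro ballI impI allI)
  fix s and \<mu> :: "'m pmf" assume s: "s \<in> \<sigma>"
  let ?f = "\<lambda>w m. expected_payoff u (c m (e' s)) (axis w 1)"
  have int: "integrable \<mu> (?f w)" for w
    using expected_payoff_axis_bounded[OF c]
    by (intro measure_pmf.integrable_const_bound[of _ "\<Sum>a\<in>UNIV. \<bar>u a w\<bar>"] AE_pmfI) auto
  have "interim_payoff u \<pi> \<sigma> (\<lambda>s. return_pmf (e' s)) c s \<mu> =
      (\<Sum>w\<in>UNIV. posterior \<pi> s $ w * measure_pmf.expectation \<mu> (?f w))"
    by (rule truthful_interim_payoff[OF \<sigma> s])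
  also have "\<dots> = measure_pmf.expectation \<mu> (\<lambda>m. \<Sum>w\<in>UNIV. posterior \<pi> s $ w * ?f w m)"
    using int by simp
  also have "\<dots> \<le> expected_payoff u (c (e s) (e' s)) (posterior \<pi> s)"
    using int opt[OF s]
    by (intro measure_pmf.integral_le_const Bochner_Integration.integrable_sum integrable_mult_right)
      (auto simp: sum_expected_payoff_axis)
  also have "\<dots> = interim_payoff u \<pi> \<sigma> (\<lambda>s. return_pmf (e' s)) c s (return_pmf (e s))"
    by (simp add: truthful_interim_payoff[OF \<sigma> s] sum_expected_payoff_axis)
  finally show "interim_payoff u \<pi> \<sigma> (\<lambda>s. return_pmf (e' s)) c s \<mu> \<le>
      interim_payoff u \<pi> \<sigma> (\<lambda>s. return_pmf (e' s)) c s (return_pmf (e s))" .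
qed

lemma truthful_payoff:
  assumes \<pi>: "\<pi> \<in> prob_simplex" and \<sigma>: "\<sigma> \<in> experiments"
    and E: "\<And>s. msg1 E \<sigma> \<sigma> s = return_pmf (e1 s)" "\<And>s. msg2 E \<sigma> \<sigma> s = return_pmf (e2 s)"
  shows "subgame_payoff u \<pi> E \<sigma> \<sigma> =
    (\<Sum>s\<in>\<sigma>. event_prob \<pi> s * expected_payoff u (act E \<sigma> \<sigma> (e1 s) (e2 s)) (posterior \<pi> s))"
proof -
  have "subgame_payoff u \<pi> E \<sigma> \<sigma> = (\<Sum>w\<in>UNIV. \<Sum>s\<in>\<sigma>. \<pi> $ w * (\<Sum>s'\<in>\<sigma>. cond_prob_state (s \<inter> s') w *
      expected_payoff u (act E \<sigma> \<sigma> (e1 s) (e2 s')) (axis w 1)))"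
    by (simp add: subgame_payoff_def E sum_distrib_left mult.assoc)
  also have "\<dots> = (\<Sum>w\<in>UNIV. \<Sum>s\<in>\<sigma>. event_prob \<pi> s *
      (posterior \<pi> s $ w * expected_payoff u (act E \<sigma> \<sigma> (e1 s) (e2 s)) (axis w 1)))"
    by (simp add: sum_cond_prob_state_same[OF \<sigma>] event_prob_posterior[OF \<pi>] flip: mult.assoc)
  also have "\<dots> = (\<Sum>s\<in>\<sigma>. event_prob \<pi> s *
      (\<Sum>w\<in>UNIV. posterior \<pi> s $ w * expected_payoff u (act E \<sigma> \<sigma> (e1 s) (e2 s)) (axis w 1)))"
    by (subst sum.swap) (simp add: sum_distrib_left)
  finally show ?thesis
    by (simp add: sum_expected_payoff_axis)
qed

section \<open>The truthful equilibrium\<close>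

theorem theorem1:
  fixes \<pi>0 :: "real ^ 'w::finite"
    and u v :: "'a::finite \<Rightarrow> 'w \<Rightarrow> real"
    and e1 :: "'w stat_experiment \<Rightarrow> 'w signal \<Rightarrow> 'm"
    and e2 :: "'w stat_experiment \<Rightarrow> 'w signal \<Rightarrow> 'n"
  assumes "\<pi>0 \<in> prob_simplex"
    and "encoding e1" and "encoding e2"
  shows "\<exists>E :: ('w, 'a, 'm, 'n) assessment.
    equilibrium \<pi>0 u v E \<and> truthful e1 e2 E \<and> equilibrium_payoff u \<pi>0 E = cav (ubar u v) \<pi>0"
proof -
  obtain \<sigma> r where \<sigma>: "\<sigma> \<in> experiments" and pos: "\<And>s. s \<in> \<sigma> \<Longrightarrow> event_prob \<pi>0 s > 0"
    and opt_value: "(\<Sum>s\<in>\<sigma>. event_prob \<pi>0 s * r s) = cav (ubar u v) \<pi>0"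
    and on_path: "\<And>s. s \<in> \<sigma> \<Longrightarrow>
      \<exists>\<alpha>\<in>BR v (posterior \<pi>0 s). expected_payoff u \<alpha> (posterior \<pi>0 s) = r s"
    and off_path: "\<And>s t. s \<in> \<sigma> \<Longrightarrow> t \<in> \<sigma> \<Longrightarrow>
      \<exists>\<rho>\<in>convex hull {posterior \<pi>0 s, posterior \<pi>0 t}. \<exists>\<alpha>\<in>BR v \<rho>.
        expected_payoff u \<alpha> (posterior \<pi>0 s) \<le> r s \<and> expected_payoff u \<alpha> (posterior \<pi>0 t) \<le> r t"
    by (rule commitment_experiment[OF assms(1), of u v]) (rule that; assumption)
  \<comment> \<open>One predicate serves both cases. For distinct reports it asks for a reply
    deterring both types; for equal reports it also forces the Bayesian belief and the promised
    payoff \<open>r s\<close>.\<close>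
  define reply where "reply = (\<lambda>s t \<rho> \<alpha>. \<rho> \<in> convex hull {posterior \<pi>0 s, posterior \<pi>0 t} \<and> \<alpha> \<in> BR v \<rho> \<and>
      expected_payoff u \<alpha> (posterior \<pi>0 s) \<le> r s \<and> expected_payoff u \<alpha> (posterior \<pi>0 t) \<le> r t \<and>
      (s = t \<longrightarrow> \<rho> = posterior \<pi>0 s \<and> expected_payoff u \<alpha> (posterior \<pi>0 s) = r s))"
  have "\<exists>\<rho> \<alpha>. reply s t \<rho> \<alpha>" if "s \<in> \<sigma>" "t \<in> \<sigma>" for s t
  proof (cases "s = t")
    case True
    then show ?thesis
      using on_path[OF that(1)] by (auto simp: reply_def)
  next
    case False
    then show ?thesis
      using off_path[OF that] by (auto simp: reply_def)
  qed
  then obtain b a where reply: "\<And>s t. s \<in> \<sigma> \<Longrightarrow> t \<in> \<sigma> \<Longrightarrow> reply s t (b s t) (a s t)"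
    by metis
  have inj: "inj_on (e1 \<sigma>) \<sigma>" "inj_on (e2 \<sigma>) \<sigma>"
    using assms(2,3) \<sigma> by (auto simp: encoding_def)
  have "\<sigma> \<noteq> {}"
    using sum_cond_prob_state_UNIV[OF \<sigma>] by auto
  then obtain s0 where s0: "s0 \<in> \<sigma>" by blast
  \<comment> \<open>Messages that encode no signal of \<sigma> are read as the report
    \<open>s0\<close>, so they open no deviation beyond misreporting.\<close>
  define d1 where "d1 = (\<lambda>m. if m \<in> e1 \<sigma> ` \<sigma> then inv_into \<sigma> (e1 \<sigma>) m else s0)"
  define d2 where "d2 = (\<lambda>n. if n \<in> e2 \<sigma> ` \<sigma> then inv_into \<sigma> (e2 \<sigma>) n else s0)"
  have d: "d1 m \<in> \<sigma>" "d2 n \<in> \<sigma>" for m n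
    using s0 inv_into_into[of m "e1 \<sigma>" \<sigma>] inv_into_into[of n "e2 \<sigma>" \<sigma>] by (auto simp: d1_def d2_def)
  have d_e: "d1 (e1 \<sigma> s) = s" "d2 (e2 \<sigma> s) = s" if "s \<in> \<sigma>" for s
    using that inj by (auto simp: d1_def d2_def)
  obtain \<alpha>0 where \<alpha>0: "\<alpha>0 \<in> BR v \<pi>0"
    using BR_nonempty by blast
  \<comment> \<open>Truth-telling is confined to the sub-game where both choose \<sigma>. Elsewhere
    the experts send the fixed message \<open>undefined\<close>, the belief stays at the prior and
    the reply is \<open>\<alpha>0\<close>. In \<open>msg2\<close> the own experiment
    \<open>\<sigma>2\<close> is the first argument.\<close>
  define E :: "('w, 'a, 'm, 'n) assessment" where "E =
    \<lparr> exp1 = \<sigma>,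
      msg1 = (\<lambda>\<sigma>1 \<sigma>2. if \<sigma>1 = \<sigma> \<and> \<sigma>2 = \<sigma> then (\<lambda>s. return_pmf (e1 \<sigma> s)) else (\<lambda>_. return_pmf undefined)),
      exp2 = \<sigma>,
      msg2 = (\<lambda>\<sigma>2 \<sigma>1. if \<sigma>1 = \<sigma> \<and> \<sigma>2 = \<sigma> then (\<lambda>s. return_pmf (e2 \<sigma> s)) else (\<lambda>_. return_pmf undefined)),
      act = (\<lambda>\<sigma>1 \<sigma>2. if \<sigma>1 = \<sigma> \<and> \<sigma>2 = \<sigma> then (\<lambda>m n. a (d1 m) (d2 n)) else (\<lambda>_ _. \<alpha>0)),
      bel = (\<lambda>\<sigma>1 \<sigma>2. if \<sigma>1 = \<sigma> \<and> \<sigma>2 = \<sigma> then (\<lambda>m n. b (d1 m) (d2 n)) else (\<lambda>_ _. \<pi>0)) \<rparr>"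
  have payoff: "subgame_payoff u \<pi>0 E \<sigma> \<sigma> = cav (ubar u v) \<pi>0"
  proof -
    have "subgame_payoff u \<pi>0 E \<sigma> \<sigma> =
        (\<Sum>s\<in>\<sigma>. event_prob \<pi>0 s * expected_payoff u (act E \<sigma> \<sigma> (e1 \<sigma> s) (e2 \<sigma> s)) (posterior \<pi>0 s))"
      by (rule truthful_payoff[OF assms(1) \<sigma>]) (simp_all add: E_def)
    also have "\<dots> = (\<Sum>s\<in>\<sigma>. event_prob \<pi>0 s * r s)"
      using reply by (intro sum.cong) (auto simp: E_def d_e reply_def)
    finally show ?thesis
      by (simp add: opt_value)
  qed
  have deviation: "subgame_payoff u \<pi>0 E \<sigma>1 \<sigma>2 \<le> cav (ubar u v) \<pi>0"
    if "\<sigma>1 \<in> experiments" "\<sigma>2 \<in> experiments" for \<sigma>1 \<sigma>2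
  proof (cases "\<sigma>1 = \<sigma> \<and> \<sigma>2 = \<sigma>")
    case False
    then have "subgame_payoff u \<pi>0 E \<sigma>1 \<sigma>2 = expected_payoff u \<alpha>0 \<pi>0"
      using that by (intro babbling_payoff) (auto simp: E_def)
    \<comment> \<open>The babbling outcome is itself a point of the payoff graph above the prior,
      hence below the top of the hull.\<close>
    also have "\<dots> \<le> cav (ubar u v) \<pi>0"
      using assms(1) \<alpha>0 by (intro cav_ubar_greatest(2) hull_inc) (auto simp: payoff_graph_iff)
    finally show ?thesis .
  qed (simp add: payoff)
  have "consistent_beliefs \<pi>0 \<sigma>1 \<sigma>2 (msg1 E \<sigma>1 \<sigma>2) (msg2 E \<sigma>2 \<sigma>1) (bel E \<sigma>1 \<sigma>2) \<and>
      (\<forall>m n. act E \<sigma>1 \<sigma>2 m n \<in> BR v (bel E \<sigma>1 \<sigma>2 m n)) \<and>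
      optimal_messages u \<pi>0 \<sigma>1 \<sigma>2 (msg1 E \<sigma>1 \<sigma>2) (msg2 E \<sigma>2 \<sigma>1) (act E \<sigma>1 \<sigma>2) \<and>
      optimal_messages u \<pi>0 \<sigma>2 \<sigma>1 (msg2 E \<sigma>2 \<sigma>1) (msg1 E \<sigma>1 \<sigma>2) (\<lambda>n m. act E \<sigma>1 \<sigma>2 m n)"
    if \<sigma>12: "\<sigma>1 \<in> experiments" "\<sigma>2 \<in> experiments" for \<sigma>1 \<sigma>2
  proof (cases "\<sigma>1 = \<sigma> \<and> \<sigma>2 = \<sigma>")
    case False
    then show ?thesis
      by (simp only: E_def assessment.simps if_False)
        (simp add: babbling_consistent[OF assms(1) \<sigma>12] babbling_optimal_messages \<alpha>0)
  next
    case True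
    have "consistent_beliefs \<pi>0 \<sigma> \<sigma> (\<lambda>s. return_pmf (e1 \<sigma> s)) (\<lambda>s. return_pmf (e2 \<sigma> s))
        (\<lambda>m n. b (d1 m) (d2 n))"
    proof (rule truthful_consistent[OF assms(1) \<sigma> inj])
      show "b (d1 (e1 \<sigma> s)) (d2 (e2 \<sigma> s)) = posterior \<pi>0 s" if "s \<in> \<sigma>" for s
        using reply[OF that that] by (simp add: d_e that reply_def)
      show "b (d1 m) (d2 n) \<in> convex hull (posterior \<pi>0 ` {s \<in> \<sigma>. event_prob \<pi>0 s > 0})" for m n
      proof (rule subsetD[OF hull_mono])
        show "{posterior \<pi>0 (d1 m), posterior \<pi>0 (d2 n)} \<subseteq> posterior \<pi>0 ` {s \<in> \<sigma>. event_prob \<pi>0 s > 0}"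
          using d pos by auto
        show "b (d1 m) (d2 n) \<in> convex hull {posterior \<pi>0 (d1 m), posterior \<pi>0 (d2 n)}"
          using reply[OF d] by (simp add: reply_def)
      qed
    qed
    moreover have br: "a (d1 m) (d2 n) \<in> BR v (b (d1 m) (d2 n))" for m n
      using reply[OF d] by (simp add: reply_def)
    \<comment> \<open>A unilateral misreport leaves the true signal \<open>s\<close> as one of the
      two reports. The reply to that pair pays at most \<open>r s\<close> at the posterior of
      \<open>s\<close>, which is what truth-telling pays.\<close>
    moreover have opt: "expected_payoff u (a (d1 m) s) (posterior \<pi>0 s) \<le> expected_payoff u (a s s) (posterior \<pi>0 s)"
      "expected_payoff u (a s (d2 n)) (posterior \<pi>0 s) \<le> expected_payoff u (a s s) (posterior \<pi>0 s)"
      if "s \<in> \<sigma>" for s m n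
      using reply[OF that that] reply[OF d(1) that] reply[OF that d(2)] by (simp_all add: reply_def)
    have "optimal_messages u \<pi>0 \<sigma> \<sigma> (\<lambda>s. return_pmf (e1 \<sigma> s)) (\<lambda>s. return_pmf (e2 \<sigma> s))
        (\<lambda>m n. a (d1 m) (d2 n))"
      "optimal_messages u \<pi>0 \<sigma> \<sigma> (\<lambda>s. return_pmf (e2 \<sigma> s)) (\<lambda>s. return_pmf (e1 \<sigma> s))
        (\<lambda>n m. a (d1 m) (d2 n))"
      by (intro truthful_optimal_messages[OF \<sigma>] BR_subset[OF br]; simp add: d_e opt)+
    ultimately show ?thesis
      using True by (simp add: E_def)
  qed
  then have "equilibrium \<pi>0 u v E"
    using \<sigma> deviation payoff by (simp add: equilibrium_def) (simp add: E_def)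
  moreover have "truthful e1 e2 E"
    by (simp add: truthful_def E_def)
  moreover have "equilibrium_payoff u \<pi>0 E = cav (ubar u v) \<pi>0"
    using payoff by (simp add: equilibrium_payoff_def) (simp add: E_def)
  ultimately show ?thesis by blast
qed

end
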